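(* Let $(M^n,g,V,\lambda,\beta)$, $n\ge4$, be an almost $\omega$-Bach soliton, where $\omega$ is the $1$-form associated to a vector field $P$, and suppose the potential vector field $V$ is an affine conformal vector field with corresponding affine conformal function $f$. Then the following are equivalent: (1) the $\omega$-Bach tensor $B_\omega$ is incompressible (divergence free), i.e. $\operatorname{div}B_\omega=0$; (2) $\mu=\lambda-f$ is constant; (3) either $B_\omega=B$ or $|P|$ is constant.
   Context: $S$ denotes the Ricci tensor and $W$ the Weyl tensor, $W=R-\frac{2}{n-2}S\odot g+\frac{r}{(n-1)(n-2)}g\odot g$ ($\odot$ is the Kulkarni-Nomizu product, normalized so that $W$ is the trace-free part of the curvature tensor $R$; $r$ is the scalar curvature). The Bach tensor is the symmetric trace-free $(0,2)$ tensor $$B(X,Y)=\frac{1}{n-3}\sum_{i,j}(\nabla_{e_i}\nabla_{e_j}W)(X,e_i,e_j,Y)+\frac{1}{n-2}\sum_{i,j}S(e_i,e_j)W(X,e_i,e_j,Y),$$ with $\{e_i\}$ a local orthonormal frame. Given a vector field $P$ with associated $1$-form $\omega(X)=g(X,P)$ and $\beta\in\mathbb{R}$, the $\omega$-Bach tensor is $B_\omega=B-\beta\,\omega\otimes\omega$. $(M^n,g,V,\lambda,\beta)$ is an almost $\omega$-Bach soliton with potential vector field $V$ if $\frac12\mathfrak{L}_Vg+B_\omega=\lambda g$ with $\lambda\in C^\infty(M)$. A vector field $V$ is affine conformal, with affine conformal function $f\in C^\infty(M)$, if $(\mathfrak{L}_V\nabla)(X,Y)=(Xf)Y+(Yf)X-g(X,Y)\nabla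 f$ for all vector fields $X,Y$, where $\nabla$ is the Levi-Civita connection and $\nabla f$ the gradient. The divergence of a symmetric $(0,2)$ tensor $T$ is $(\operatorname{div}T)(Z)=\sum_i(\nabla_{e_i}T)(e_i,Z)$.
   Formalization: The formal theorem assumes that M is connected, which the statement leaves implicit; on a disconnected manifold the claim fails, since f may be a different constant on each component (for instance V = 0, P = 0 on two copies of flat space). *)

theory Defs
  imports "HOL-Analysis.Analysis"
begin

section \<open>Smooth maps between open subsets of Euclidean spaces\<close>

fun times_differentiable_on ::
  "nat \<Rightarrow> 'a set \<Rightarrow> ('a::euclidean_space \<Rightarrow> 'b::euclidean_space) \<Rightarrow> bool"
where
  "times_differentiable_on 0 S F \<longleftrightarrow> continuous_on S F"
| "times_differentiable_on (Suc k) S F \<longleftrightarrow>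
     (\<forall>x\<in>S. F differentiable (at x)) \<and>
     (\<forall>v. times_differentiable_on k S (\<lambda>x. frechet_derivative F (at x) v))"

text \<open>Only used for open \<open>S\<close>, so that \<open>at x\<close> and \<open>at x within S\<close> agree.\<close>

definition smooth_on ::
  "'a set \<Rightarrow> ('a::euclidean_space \<Rightarrow> 'b::euclidean_space) \<Rightarrow> bool"
  where "smooth_on S F \<longleftrightarrow> (\<forall>k. times_differentiable_on k S F)"


section \<open>Manifolds, smooth functions, vector fields and Riemannian metrics\<close>

text \<open>
  The manifold \<open>M\<close> is the universe of a Hausdorff, second countable type \<open>'m\<close>; it is modelled on
  the Euclidean space \<open>'a\<close>, so its dimension is \<open>DIM('a)\<close>. A chart is a pair \<open>(U, \<phi>)\<close>, of which
  only the values of \<open>\<phi>\<close> on \<open>U\<close> matter.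
\<close>

type_synonym ('m, 'a) chart = "'m set \<times> ('m \<Rightarrow> 'a)"

definition coord_inv :: "('m, 'a) chart \<Rightarrow> 'a \<Rightarrow> 'm"
  where "coord_inv c = inv_into (fst c) (snd c)"

definition chart_image :: "('m, 'a) chart \<Rightarrow> 'a set"
  where "chart_image c = snd c ` fst c"

definition is_chart ::
  "('m::{t2_space, second_countable_topology}, 'a::euclidean_space) chart \<Rightarrow> bool"
  where "is_chart c \<longleftrightarrow>
    open (fst c) \<and> open (chart_image c) \<and>
    homeomorphism (fst c) (chart_image c) (snd c) (coord_inv c)"

definition transition :: "('m, 'a) chart \<Rightarrow> ('m, 'a) chart \<Rightarrow> 'a \<Rightarrow> 'a"
  where "transition c d = snd d \<circ> coord_inv c"

definition smooth_atlas ::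
  "('m::{t2_space, second_countable_topology}, 'a::euclidean_space) chart set \<Rightarrow> bool"
  where "smooth_atlas A \<longleftrightarrow>
    (\<forall>c\<in>A. is_chart c) \<and> (\<Union>c\<in>A. fst c) = UNIV \<and>
    (\<forall>c\<in>A. \<forall>d\<in>A. smooth_on (snd c ` (fst c \<inter> fst d)) (transition c d))"

definition smooth_function ::
  "('m, 'a::euclidean_space) chart set \<Rightarrow> ('m \<Rightarrow> real) \<Rightarrow> bool"
  where "smooth_function A f \<longleftrightarrow> (\<forall>c\<in>A. smooth_on (chart_image c) (f \<circ> coord_inv c))"

text \<open>
  A vector field is given by its coordinate representations \<open>X c : chart_image c \<rightarrow> 'a\<close>, one for
  every chart \<open>c\<close> of the atlas, subject to the transformation law of tangent vectors. A Riemannian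
  metric is treated in the same way; \<open>G c x u v\<close> is the value at the point with coordinates \<open>x\<close> on
  the tangent vectors with components \<open>u\<close> and \<open>v\<close> in the chart \<open>c\<close>.
\<close>

definition vector_field ::
  "('m, 'a::euclidean_space) chart set \<Rightarrow> (('m, 'a) chart \<Rightarrow> 'a \<Rightarrow> 'a) \<Rightarrow> bool"
  where "vector_field A X \<longleftrightarrow>
    (\<forall>c\<in>A. smooth_on (chart_image c) (X c)) \<and>
    (\<forall>c\<in>A. \<forall>d\<in>A. \<forall>p\<in>fst c \<inter> fst d.
       X d (snd d p) = frechet_derivative (transition c d) (at (snd c p)) (X c (snd c p)))"

definition riemannian_metric ::
  "('m, 'a::euclidean_space) chart set \<Rightarrow>
     (('m, 'a) chart \<Rightarrow> 'a \<Rightarrow> 'a \<Rightarrow> 'a \<Rightarrow> real) \<Rightarrow> bool"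
  where "riemannian_metric A G \<longleftrightarrow>
    (\<forall>c\<in>A. \<forall>x\<in>chart_image c. bilinear (G c x) \<and> (\<forall>u v. G c x u v = G c x v u) \<and>
       (\<forall>u. u \<noteq> 0 \<longrightarrow> G c x u u > 0)) \<and>
    (\<forall>c\<in>A. \<forall>u v. smooth_on (chart_image c) (\<lambda>x. G c x u v)) \<and>
    (\<forall>c\<in>A. \<forall>d\<in>A. \<forall>p\<in>fst c \<inter> fst d. \<forall>u v.
       G c (snd c p) u v =
       G d (snd d p) (frechet_derivative (transition c d) (at (snd c p)) u)
                     (frechet_derivative (transition c d) (at (snd c p)) v))"


section \<open>Local Riemannian geometry in a chart\<close>

text \<open>
  Below \<open>g\<close> is the coordinate representation of the metric in one chart, \<open>X\<close>, \<open>Y\<close>, \<open>V\<close> are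
  coordinate representations of vector fields, and \<open>(0,k)\<close> tensor fields are functions of the point
  and of \<open>k\<close> tangent vectors. The value of a tensor on tangent vectors is computed by extending
  these to the vector fields \<open>\<lambda>_. u\<close> with constant components, which is legitimate as a tensor
  does not depend on the extension.
\<close>

type_synonym 'a metric = "'a \<Rightarrow> 'a \<Rightarrow> 'a \<Rightarrow> real"
type_synonym 'a tensor2 = "'a \<Rightarrow> 'a \<Rightarrow> 'a \<Rightarrow> real"
type_synonym 'a tensor4 = "'a \<Rightarrow> 'a \<Rightarrow> 'a \<Rightarrow> 'a \<Rightarrow> 'a \<Rightarrow> real"

definition dir_deriv ::
  "('a::euclidean_space \<Rightarrow> 'b::euclidean_space) \<Rightarrow> 'a \<Rightarrow> 'a \<Rightarrow> 'b"
  where "dir_deriv F x u = frechet_derivative F (at x) u"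

definition orthonormal_basis :: "('a::euclidean_space \<Rightarrow> 'a \<Rightarrow> real) \<Rightarrow> 'a set \<Rightarrow> bool"
  where "orthonormal_basis b E \<longleftrightarrow>
    finite E \<and> card E = DIM('a) \<and> (\<forall>u\<in>E. \<forall>v\<in>E. b u v = (if u = v then 1 else 0))"

text \<open>
  Summation over an orthonormal basis of the tangent space with inner product \<open>b\<close>. In all uses
  below each basis vector is inserted into two slots of a tensor, so that the result does not depend
  on the choice of the basis.
\<close>

definition frame_sum ::
  "('a::euclidean_space \<Rightarrow> 'a \<Rightarrow> real) \<Rightarrow> ('a \<Rightarrow> real) \<Rightarrow> real"
  where "frame_sum b F = (\<Sum>e\<in>(SOME E. orthonormal_basis b E). F e)"

definition sharp :: "('a::euclidean_space \<Rightarrow> 'a \<Rightarrow> real) \<Rightarrow> ('a \<Rightarrow> real) \<Rightarrow> 'a"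
  where "sharp b l = (THE w. \<forall>z. b w z = l z)"

definition gradient :: "'a::euclidean_space metric \<Rightarrow> ('a \<Rightarrow> real) \<Rightarrow> 'a \<Rightarrow> 'a"
  where "gradient g f x = sharp (g x) (\<lambda>z. dir_deriv f x z)"

definition lie_bracket ::
  "('a::euclidean_space \<Rightarrow> 'a) \<Rightarrow> ('a \<Rightarrow> 'a) \<Rightarrow> 'a \<Rightarrow> 'a"
  where "lie_bracket X Y x = dir_deriv Y x (X x) - dir_deriv X x (Y x)"

text \<open>
  The Christoffel term \<open>\<Gamma>(u,v)\<close> of the Levi-Civita connection: the Koszul formula for vector fields
  with constant components, whose brackets vanish.
\<close>

definition christoffel :: "'a::euclidean_space metric \<Rightarrow> 'a \<Rightarrow> 'a \<Rightarrow> 'a \<Rightarrow> 'a"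
  where "christoffel g x u v = sharp (g x) (\<lambda>z.
    (dir_deriv (\<lambda>y. g y v z) x u + dir_deriv (\<lambda>y. g y u z) x v
      - dir_deriv (\<lambda>y. g y u v) x z) / 2)"

definition nabla ::
  "'a::euclidean_space metric \<Rightarrow> ('a \<Rightarrow> 'a) \<Rightarrow> ('a \<Rightarrow> 'a) \<Rightarrow> 'a \<Rightarrow> 'a"
  where "nabla g X Y x = dir_deriv Y x (X x) + christoffel g x (X x) (Y x)"

definition nabla2 ::
  "'a::euclidean_space metric \<Rightarrow> ('a \<Rightarrow> 'a) \<Rightarrow> 'a tensor2 \<Rightarrow> 'a tensor2"
  where "nabla2 g X T x u v =
    dir_deriv (\<lambda>y. T y u v) x (X x)
      - T x (christoffel g x (X x) u) v - T x u (christoffel g x (X x) v)"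

definition nabla4 ::
  "'a::euclidean_space metric \<Rightarrow> ('a \<Rightarrow> 'a) \<Rightarrow> 'a tensor4 \<Rightarrow> 'a tensor4"
  where "nabla4 g X T x u v w z =
    dir_deriv (\<lambda>y. T y u v w z) x (X x)
      - T x (christoffel g x (X x) u) v w z - T x u (christoffel g x (X x) v) w z
      - T x u v (christoffel g x (X x) w) z - T x u v w (christoffel g x (X x) z)"

text \<open>The second covariant derivative \<open>\<nabla>\<^sub>X \<nabla>\<^sub>Y T - \<nabla>\<^bsub>\<nabla>\<^sub>X Y\<^esub> T\<close> at \<open>x\<close>, with \<open>X(x) = a\<close> and \<open>Y(x) = b\<close>.\<close>

definition second_nabla4 ::
  "'a::euclidean_space metric \<Rightarrow> 'a \<Rightarrow> 'a \<Rightarrow> 'a tensor4 \<Rightarrow> 'a tensor4"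
  where "second_nabla4 g a b T x u v w z =
    nabla4 g (\<lambda>_. a) (nabla4 g (\<lambda>_. b) T) x u v w z
      - nabla4 g (nabla g (\<lambda>_. a) (\<lambda>_. b)) T x u v w z"

definition curvature ::
  "'a::euclidean_space metric \<Rightarrow> ('a \<Rightarrow> 'a) \<Rightarrow> ('a \<Rightarrow> 'a) \<Rightarrow> ('a \<Rightarrow> 'a) \<Rightarrow> 'a \<Rightarrow> 'a"
  where "curvature g X Y Z x =
    nabla g X (nabla g Y Z) x - nabla g Y (nabla g X Z) x - nabla g (lie_bracket X Y) Z x"

text \<open>
  Sign convention: \<open>R(X,Y,Z,W) = g(R(X,Y)Z, W)\<close> and \<open>S(Y,Z) = \<Sum>\<^sub>i R(e\<^sub>i,Y,Z,e\<^sub>i)\<close>, so that the round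
  unit sphere has \<open>S = (n-1) g\<close>.
\<close>

definition riemann :: "'a::euclidean_space metric \<Rightarrow> 'a tensor4"
  where "riemann g x u v w z = g x (curvature g (\<lambda>_. u) (\<lambda>_. v) (\<lambda>_. w) x) z"

definition ricci :: "'a::euclidean_space metric \<Rightarrow> 'a tensor2"
  where "ricci g x v w = frame_sum (g x) (\<lambda>e. riemann g x e v w e)"

definition scalar_curvature :: "'a::euclidean_space metric \<Rightarrow> 'a \<Rightarrow> real"
  where "scalar_curvature g x = frame_sum (g x) (\<lambda>e. ricci g x e e)"

text \<open>
  The Kulkarni-Nomizu product, with the factor \<open>1/2\<close> and the sign for which
  \<open>(g \<odot> g)(X,Y,Z,W) = g(Y,Z) g(X,W) - g(X,Z) g(Y,W)\<close> is the curvature tensor of the round unit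
  sphere. With this normalization the tensor \<open>weyl\<close> below is trace-free.
\<close>

definition kulkarni_nomizu ::
  "'a::euclidean_space tensor2 \<Rightarrow> 'a tensor2 \<Rightarrow> 'a tensor4"
  where "kulkarni_nomizu h k x u v w z =
    (h x u z * k x v w + h x v w * k x u z - h x u w * k x v z - h x v z * k x u w) / 2"

definition weyl :: "'a::euclidean_space metric \<Rightarrow> 'a tensor4"
  where "weyl g x u v w z =
    riemann g x u v w z
      - 2 / (real DIM('a) - 2) * kulkarni_nomizu (ricci g) g x u v w z
      + scalar_curvature g x / ((real DIM('a) - 1) * (real DIM('a) - 2))
          * kulkarni_nomizu g g x u v w z"

definition bach :: "'a::euclidean_space metric \<Rightarrow> 'a tensor2"
  where "bach g x u v =
    1 / (real DIM('a) - 3) *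
      frame_sum (g x) (\<lambda>a. frame_sum (g x) (\<lambda>b. second_nabla4 g a b (weyl g) x u a b v))
    + 1 / (real DIM('a) - 2) *
      frame_sum (g x) (\<lambda>a. frame_sum (g x) (\<lambda>b. ricci g x a b * weyl g x u a b v))"

definition one_form :: "'a::euclidean_space metric \<Rightarrow> ('a \<Rightarrow> 'a) \<Rightarrow> 'a \<Rightarrow> 'a \<Rightarrow> real"
  where "one_form g P x u = g x u (P x)"

definition omega_bach ::
  "'a::euclidean_space metric \<Rightarrow> ('a \<Rightarrow> 'a) \<Rightarrow> real \<Rightarrow> 'a tensor2"
  where "omega_bach g P \<beta> x u v =
    bach g x u v - \<beta> * (one_form g P x u * one_form g P x v)"

definition divergence :: "'a::euclidean_space metric \<Rightarrow> 'a tensor2 \<Rightarrow> 'a \<Rightarrow> 'a \<Rightarrow> real"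
  where "divergence g T x z = frame_sum (g x) (\<lambda>e. nabla2 g (\<lambda>_. e) T x e z)"

definition lie_metric ::
  "'a::euclidean_space metric \<Rightarrow> ('a \<Rightarrow> 'a) \<Rightarrow> ('a \<Rightarrow> 'a) \<Rightarrow> ('a \<Rightarrow> 'a) \<Rightarrow> 'a \<Rightarrow> real"
  where "lie_metric g V X Y x =
    dir_deriv (\<lambda>y. g y (X y) (Y y)) x (V x)
      - g x (lie_bracket V X x) (Y x) - g x (X x) (lie_bracket V Y x)"

definition lie_connection ::
  "'a::euclidean_space metric \<Rightarrow> ('a \<Rightarrow> 'a) \<Rightarrow> ('a \<Rightarrow> 'a) \<Rightarrow> ('a \<Rightarrow> 'a) \<Rightarrow> 'a \<Rightarrow> 'a"
  where "lie_connection g V X Y x =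
    lie_bracket V (nabla g X Y) x
      - nabla g (lie_bracket V X) Y x - nabla g X (lie_bracket V Y) x"


section \<open>Solitons and affine conformal vector fields\<close>

definition almost_omega_bach_soliton ::
  "('m, 'a::euclidean_space) chart set \<Rightarrow> (('m, 'a) chart \<Rightarrow> 'a metric) \<Rightarrow>
     (('m, 'a) chart \<Rightarrow> 'a \<Rightarrow> 'a) \<Rightarrow> (('m, 'a) chart \<Rightarrow> 'a \<Rightarrow> 'a) \<Rightarrow> ('m \<Rightarrow> real) \<Rightarrow> real \<Rightarrow> bool"
  where "almost_omega_bach_soliton A G P V lam \<beta> \<longleftrightarrow>
    riemannian_metric A G \<and> vector_field A P \<and> vector_field A V \<and> smooth_function A lam \<and>
    (\<forall>c\<in>A. \<forall>x\<in>chart_image c. \<forall>u v.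
       1 / 2 * lie_metric (G c) (V c) (\<lambda>_. u) (\<lambda>_. v) x + omega_bach (G c) (P c) \<beta> x u v
         = lam (coord_inv c x) * G c x u v)"

definition affine_conformal ::
  "('m, 'a::euclidean_space) chart set \<Rightarrow> (('m, 'a) chart \<Rightarrow> 'a metric) \<Rightarrow>
     (('m, 'a) chart \<Rightarrow> 'a \<Rightarrow> 'a) \<Rightarrow> ('m \<Rightarrow> real) \<Rightarrow> bool"
  where "affine_conformal A G V f \<longleftrightarrow>
    vector_field A V \<and> smooth_function A f \<and>
    (\<forall>X Y. vector_field A X \<longrightarrow> vector_field A Y \<longrightarrow>
      (\<forall>c\<in>A. \<forall>x\<in>chart_image c.
         lie_connection (G c) (V c) (X c) (Y c) x =
           dir_deriv (f \<circ> coord_inv c) x (X c x) *\<^sub>R Y c x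
           + dir_deriv (f \<circ> coord_inv c) x (Y c x) *\<^sub>R X c x
           - G c x (X c x) (Y c x) *\<^sub>R gradient (G c) (f \<circ> coord_inv c) x))"

end

theory Submission
  imports Defs
begin

text \<open>
  For every vector field \<open>V\<close> one has
  \<open>(\<nabla>\<^sub>X L\<^sub>V g)(Y, Z) = g((L\<^sub>V \<nabla>)(X, Y), Z) + g((L\<^sub>V \<nabla>)(X, Z), Y)\<close>, so an affine conformal \<open>V\<close>
  satisfies \<open>\<nabla>\<^sub>X L\<^sub>V g = 2 (Xf) g\<close>, and the soliton equation gives \<open>\<nabla>\<^sub>X B\<^sub>\<omega> = (X\<mu>) g\<close> with
  \<open>\<mu> = \<lambda> - f\<close>. Contracting \<open>X\<close> with a slot of \<open>B\<^sub>\<omega>\<close> yields \<open>div B\<^sub>\<omega> = d\<mu>\<close>. Taking the trace instead,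
  and using that \<open>B\<close> is trace-free, yields \<open>- \<beta> X|P|\<^sup>2 = n X\<mu>\<close>. Thus each of the three conditions
  says that \<open>d\<mu> = 0\<close> on the connected manifold \<open>M\<close>.
\<close>

section \<open>Calculus of smooth maps\<close>

text \<open>The traces in the definitions run over an orthonormal basis chosen by
  \<open>SOME\<close> separately at each point, so they cannot be differentiated term by term. They
  are rewritten as coordinate traces of \<open>sharp (g x) (T x i)\<close>; the analytic core is
  therefore that raising an index, given only implicitly by a \<open>THE\<close>, is a smooth
  operation. It follows that contraction commutes with \<nabla>. This gives tr B = 0: W is
  trace-free in its outer slots, hence so are its covariant derivatives, and the definition of B
  leaves exactly these slots free. It also gives the trace of \<nabla>B_\<omega>, where the
  smoothness of B_\<omega> is read off from the soliton equation. A second obstacle is that the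
  affine conformal condition speaks of global vector fields, whereas the computation takes place in
  a chart with constant ones; bump functions bridge this gap. The alternative in the last condition
  arises because \<beta> is a real number: if \<beta> |P|^2 is constant, then \<beta> = 0 or |P| is
  constant.\<close>

lemma has_dir_deriv:
  "F differentiable (at x) \<Longrightarrow> (F has_derivative dir_deriv F x) (at x)"
  by (metis dir_deriv_def frechet_derivative_works has_derivative_eq_rhs ext)

lemma dir_deriv_eqI:
  "(F has_derivative F') (at x) \<Longrightarrow> dir_deriv F x = F'"
  by (metis dir_deriv_def frechet_derivative_at ext)

lemma linear_dir_deriv: "F differentiable (at x) \<Longrightarrow> linear (dir_deriv F x)"
  using has_derivative_linear has_dir_deriv by blast

text \<open>\<open>frechet_derivative\<close> picks some member of the set of derivatives, and
  functions that agree near \<open>x\<close> have the same such set; so the equation also covers the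
  unspecified value at points of non-differentiability.\<close>

lemma dir_deriv_cong_open:
  assumes "open S" "x \<in> S" "\<And>y. y \<in> S \<Longrightarrow> F y = H y"
  shows "dir_deriv F x = dir_deriv H x"
proof -
  have "(F has_derivative D) (at x) \<longleftrightarrow> (H has_derivative D) (at x)" for D
    using assms has_derivative_transform_within_open[of _ D x UNIV S] by auto
  then show ?thesis
    unfolding dir_deriv_def frechet_derivative_def by presburger
qed

lemma dir_deriv_const [simp]: "dir_deriv (\<lambda>_. c) x v = 0"
  by (simp add: dir_deriv_def frechet_derivative_const)

lemma dir_deriv_ident [simp]: "dir_deriv (\<lambda>x. x) x v = v"
  by (simp add: dir_deriv_def)

lemma dir_deriv_add:
  assumes "F differentiable (at x)" "H differentiable (at x)"
  shows "dir_deriv (\<lambda>y. F y + H y) x v = dir_deriv F x v + dir_deriv H x v"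
  using has_derivative_add[OF assms[THEN has_dir_deriv]] by (simp add: dir_deriv_eqI)

lemma dir_deriv_diff:
  assumes "F differentiable (at x)" "H differentiable (at x)"
  shows "dir_deriv (\<lambda>y. F y - H y) x v = dir_deriv F x v - dir_deriv H x v"
  using has_derivative_diff[OF assms[THEN has_dir_deriv]] by (simp add: dir_deriv_eqI)

lemma dir_deriv_sum:
  assumes "\<And>i. i \<in> I \<Longrightarrow> F i differentiable (at x)"
  shows "dir_deriv (\<lambda>y. \<Sum>i\<in>I. F i y) x v = (\<Sum>i\<in>I. dir_deriv (F i) x v)"
  using has_derivative_sum[of I F, OF has_dir_deriv[OF assms]] by (simp add: dir_deriv_eqI)

lemma dir_deriv_bilinear:
  assumes "bounded_bilinear B" "F differentiable (at x)" "H differentiable (at x)"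
  shows "dir_deriv (\<lambda>y. B (F y) (H y)) x v = B (F x) (dir_deriv H x v) + B (dir_deriv F x v) (H x)"
  using bounded_bilinear.FDERIV[OF assms(1) assms(2,3)[THEN has_dir_deriv]]
  by (simp add: dir_deriv_eqI)

lemmas dir_deriv_mult = dir_deriv_bilinear[OF bounded_bilinear_mult]

lemma dir_deriv_linear:
  assumes "bounded_linear L" "F differentiable (at x)"
  shows "dir_deriv (\<lambda>y. L (F y)) x v = L (dir_deriv F x v)"
  using bounded_linear.has_derivative[OF assms(1) assms(2)[THEN has_dir_deriv]]
  by (simp add: dir_deriv_eqI)

lemma dir_deriv_chain:
  assumes "H differentiable (at (F x))" "F differentiable (at x)"
  shows "dir_deriv (\<lambda>y. H (F y)) x v = dir_deriv H (F x) (dir_deriv F x v)"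
  using diff_chain_at[OF assms(2,1)[THEN has_dir_deriv]]
  by (simp add: dir_deriv_eqI o_def)

lemma times_differentiable_on_Suc:
  "times_differentiable_on (Suc k) S F \<longleftrightarrow>
     (\<forall>x\<in>S. F differentiable (at x)) \<and> (\<forall>v. times_differentiable_on k S (\<lambda>x. dir_deriv F x v))"
  by (simp add: dir_deriv_def)

declare times_differentiable_on.simps(2) [simp del]

lemma times_differentiable_on_cong:
  assumes "open S" "\<And>x. x \<in> S \<Longrightarrow> F x = H x"
  shows "times_differentiable_on k S F \<longleftrightarrow> times_differentiable_on k S H"
  using assms(2)
proof (induction k arbitrary: F H)
  case 0
  then show ?case by (simp cong: continuous_on_cong)
next
  case (Suc k)
  have "F differentiable (at x) \<longleftrightarrow> H differentiable (at x)" if "x \<in> S" for x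
    using that Suc.prems assms(1) has_derivative_transform_within_open[of _ _ x UNIV S]
    unfolding differentiable_def by (smt (verit, best))
  moreover have "times_differentiable_on k S (\<lambda>x. dir_deriv F x v) \<longleftrightarrow>
      times_differentiable_on k S (\<lambda>x. dir_deriv H x v)" for v
    by (rule Suc.IH) (use dir_deriv_cong_open[OF assms(1) _ Suc.prems] in auto)
  ultimately show ?case
    unfolding times_differentiable_on_Suc by simp
qed

lemma times_differentiable_on_continuous:
  "times_differentiable_on k S F \<Longrightarrow> continuous_on S F"
  by (cases k) (simp_all add: times_differentiable_on_Suc continuous_at_imp_continuous_on
      differentiable_imp_continuous_within)

lemma times_differentiable_on_SucD:
  "times_differentiable_on (Suc k) S F \<Longrightarrow> times_differentiable_on k S F"
proof (induction k arbitrary: F)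
  case 0
  then show ?case by (simp add: times_differentiable_on_continuous)
next
  case (Suc k)
  from Suc.prems have "\<forall>x\<in>S. F differentiable (at x)"
    "\<forall>v. times_differentiable_on (Suc k) S (\<lambda>x. dir_deriv F x v)"
    using times_differentiable_on_Suc[of "Suc k" S F] by blast+
  with Suc.IH show ?case using times_differentiable_on_Suc[of k S F] by blast
qed

text \<open>Serves to glue: a field defined by cases is smooth once each point has a neighbourhood
  on which it is smooth.\<close>

lemma times_differentiable_on_local:
  assumes "\<And>x. x \<in> S \<Longrightarrow> \<exists>U. open U \<and> x \<in> U \<and> times_differentiable_on k U F"
  shows "times_differentiable_on k S F"
  using assms
proof (induction k arbitrary: F)
  case 0
  then have "continuous (at x) F" if "x \<in> S" for x
    using that by (metis continuous_on_eq_continuous_at times_differentiable_on.simps(1))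
  then show ?case by (simp add: continuous_at_imp_continuous_on)
next
  case (Suc k)
  then show ?case unfolding times_differentiable_on_Suc by meson
qed

lemma times_differentiable_on_const: "times_differentiable_on k S (\<lambda>_. c)"
  by (induction k arbitrary: c) (auto simp: times_differentiable_on_Suc)

lemma times_differentiable_on_ident: "times_differentiable_on k S (\<lambda>x. x)"
  by (cases k) (auto simp: times_differentiable_on_Suc times_differentiable_on_const)

lemma times_differentiable_on_add:
  assumes "open S"
  shows "times_differentiable_on k S F \<Longrightarrow> times_differentiable_on k S H \<Longrightarrow>
    times_differentiable_on k S (\<lambda>x. F x + H x)"
proof (induction k arbitrary: F H)
  case 0
  then show ?case by (auto intro: continuous_intros)
next
  case (Suc k)
  show ?case
    unfolding times_differentiable_on_Suc
  proof (intro conjI allI ballI)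
    fix v
    have "times_differentiable_on k S (\<lambda>x. dir_deriv F x v + dir_deriv H x v)"
      by (rule Suc.IH) (use Suc.prems in \<open>simp_all add: times_differentiable_on_Suc\<close>)
    then show "times_differentiable_on k S (\<lambda>x. dir_deriv (\<lambda>x. F x + H x) x v)"
      using Suc.prems by (subst times_differentiable_on_cong[OF assms])
        (simp_all add: times_differentiable_on_Suc dir_deriv_add)
  qed (use Suc.prems in \<open>auto simp: times_differentiable_on_Suc\<close>)
qed

text \<open>One induction for products, scalar multiples and inner products alike. It runs over all
  pairs at once because the Leibniz rule pairs \<open>F\<close> with a derivative of
  \<open>H\<close> and vice versa.\<close>

lemma times_differentiable_on_bilinear:
  assumes "open S" and B: "bounded_bilinear B"
  shows "times_differentiable_on k S F \<Longrightarrow> times_differentiable_on k S H \<Longrightarrow>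
    times_differentiable_on k S (\<lambda>x. B (F x) (H x))"
proof (induction k arbitrary: F H)
  case 0
  then show ?case using bounded_bilinear.continuous_on[OF B] by auto
next
  case (Suc k)
  show ?case
    unfolding times_differentiable_on_Suc
  proof (intro conjI allI ballI)
    fix x assume "x \<in> S"
    then show "(\<lambda>x. B (F x) (H x)) differentiable at x"
      using Suc.prems bounded_bilinear.FDERIV[OF B] unfolding times_differentiable_on_Suc differentiable_def
      by blast
  next
    fix v
    have "times_differentiable_on k S (\<lambda>x. B (F x) (dir_deriv H x v) + B (dir_deriv F x v) (H x))"
      by (intro times_differentiable_on_add[OF assms(1)] Suc.IH)
        (use Suc.prems in \<open>simp_all add: times_differentiable_on_SucD, simp_all add: times_differentiable_on_Suc\<close>)
    then show "times_differentiable_on k S (\<lambda>x. dir_deriv (\<lambda>x. B (F x) (H x)) x v)"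
      using Suc.prems by (subst times_differentiable_on_cong[OF assms(1)])
        (simp_all add: times_differentiable_on_Suc dir_deriv_bilinear[OF B])
  qed
qed

lemmas times_differentiable_on_mult = times_differentiable_on_bilinear[OF _ bounded_bilinear_mult]
lemmas times_differentiable_on_scaleR = times_differentiable_on_bilinear[OF _ bounded_bilinear_scaleR]

lemma times_differentiable_on_linear:
  assumes "open S" and L: "bounded_linear L"
  shows "times_differentiable_on k S F \<Longrightarrow> times_differentiable_on k S (\<lambda>x. L (F x))"
proof (induction k arbitrary: F)
  case 0
  then show ?case using bounded_linear.continuous_on[OF L] by auto
next
  case (Suc k)
  show ?case
    unfolding times_differentiable_on_Suc
  proof (intro conjI allI ballI)
    fix x assume "x \<in> S"
    then show "(\<lambda>x. L (F x)) differentiable at x"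
      using Suc.prems bounded_linear.has_derivative[OF L] unfolding times_differentiable_on_Suc differentiable_def
      by blast
  next
    fix v
    have "times_differentiable_on k S (\<lambda>x. L (dir_deriv F x v))"
      by (rule Suc.IH) (use Suc.prems in \<open>simp add: times_differentiable_on_Suc\<close>)
    then show "times_differentiable_on k S (\<lambda>x. dir_deriv (\<lambda>x. L (F x)) x v)"
      using Suc.prems by (subst times_differentiable_on_cong[OF assms(1)])
        (simp_all add: times_differentiable_on_Suc dir_deriv_linear[OF L])
  qed
qed

lemma times_differentiable_on_diff:
  assumes "open S" "times_differentiable_on k S F" "times_differentiable_on k S H"
  shows "times_differentiable_on k S (\<lambda>x. F x - H x)"
  using times_differentiable_on_add[OF assms(1,2) times_differentiable_on_linear[OF assms(1)
        bounded_linear_minus[OF bounded_linear_ident] assms(3)]]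
  by simp

lemma times_differentiable_on_sum:
  assumes "open S" "\<And>i. i \<in> I \<Longrightarrow> times_differentiable_on k S (F i)"
  shows "times_differentiable_on k S (\<lambda>x. \<Sum>i\<in>I. F i x)"
  using assms(2)
  by (induction I rule: infinite_finite_induct)
    (simp_all add: times_differentiable_on_const times_differentiable_on_add[OF assms(1)])

text \<open>The derivative -F' / F^2 again contains the inverse, but one order of differentiability
  less is asked of it; the induction hypothesis covers that occurrence.\<close>

lemma times_differentiable_on_inverse:
  fixes F :: "'a::euclidean_space \<Rightarrow> real"
  assumes "open S" "\<And>x. x \<in> S \<Longrightarrow> F x \<noteq> 0"
  shows "times_differentiable_on k S F \<Longrightarrow> times_differentiable_on k S (\<lambda>x. inverse (F x))"
proof (induction k)
  case 0
  then show ?case using assms by (auto intro!: continuous_intros)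
next
  case (Suc k)
  have der: "((\<lambda>x. inverse (F x)) has_derivative
      (\<lambda>h. - (inverse (F x) * dir_deriv F x h * inverse (F x)))) (at x)" if "x \<in> S" for x
    using Suc.prems that assms(2) Deriv.has_derivative_inverse[OF _ has_dir_deriv]
    by (auto simp: times_differentiable_on_Suc)
  have F: "times_differentiable_on k S (\<lambda>x. inverse (F x))"
    using Suc.IH[OF times_differentiable_on_SucD[OF Suc.prems]] .
  show ?case
    unfolding times_differentiable_on_Suc
  proof (intro conjI allI ballI)
    fix x assume "x \<in> S"
    then show "(\<lambda>x. inverse (F x)) differentiable at x"
      by (rule differentiableI[OF der])
  next
    fix v
    have "times_differentiable_on k S (\<lambda>x. - (inverse (F x) * dir_deriv F x v * inverse (F x)))"
      using Suc.prems times_differentiable_on_Suc[of k S F] F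
      by (intro times_differentiable_on_linear[where L = uminus, OF assms(1)]
          times_differentiable_on_mult assms F bounded_linear_minus bounded_linear_ident) blast
    then show "times_differentiable_on k S (\<lambda>x. dir_deriv (\<lambda>x. inverse (F x)) x v)"
      by (subst times_differentiable_on_cong[OF assms(1)]) (auto simp: dir_deriv_eqI[OF der])
  qed
qed

lemma linear_euclidean_expansion:
  fixes L :: "'a::euclidean_space \<Rightarrow> 'b::real_vector"
  assumes "linear L"
  shows "L u = (\<Sum>b\<in>Basis. (u \<bullet> b) *\<^sub>R L b)"
proof -
  have "L u = L (\<Sum>b\<in>Basis. (u \<bullet> b) *\<^sub>R b)" by (simp add: euclidean_representation)
  also have "\<dots> = (\<Sum>b\<in>Basis. (u \<bullet> b) *\<^sub>R L b)"
    using assms by (simp add: linear_sum linear_scale)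
  finally show ?thesis .
qed

lemma inner_Basis_sum:
  "(\<Sum>i\<in>Basis. c i *\<^sub>R i) \<bullet> (z::'a::euclidean_space) = (\<Sum>i\<in>Basis. (z \<bullet> i) * c i)"
  unfolding inner_sum_left by (rule sum.cong) (auto simp: inner_commute)

text \<open>Expanding \<open>X x\<close> in the standard basis reduces a moving argument to finitely
  many fixed ones. This is why smoothness of metrics and tensors can be stated on fixed
  vectors.\<close>

lemma times_differentiable_on_linear_family:
  fixes L :: "'a::euclidean_space \<Rightarrow> 'b::euclidean_space \<Rightarrow> 'c::euclidean_space"
  assumes "open S" "\<And>x. x \<in> S \<Longrightarrow> linear (L x)" "\<And>v. times_differentiable_on k S (\<lambda>x. L x v)"
    and "times_differentiable_on k S X"
  shows "times_differentiable_on k S (\<lambda>x. L x (X x))"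
proof -
  have "times_differentiable_on k S (\<lambda>x. \<Sum>b\<in>Basis. (X x \<bullet> b) *\<^sub>R L x b)"
    by (intro times_differentiable_on_sum times_differentiable_on_scaleR assms
        times_differentiable_on_linear[where F = X, OF _ bounded_linear_inner_left])
  then show ?thesis
    using assms(1,2) by (subst times_differentiable_on_cong)
      (auto simp: linear_euclidean_expansion[of "L _" "X _"])
qed

text \<open>By the chain rule the derivative is the linear family \<open>dir_deriv H (F x)\<close>
  applied to a moving vector. The induction hypothesis is applied to the directional derivatives of
  \<open>H\<close>, with \<open>F\<close> kept fixed.\<close>

lemma times_differentiable_on_compose:
  assumes "open S" "open T" "F ` S \<subseteq> T"
  shows "times_differentiable_on k T H \<Longrightarrow> times_differentiable_on k S F \<Longrightarrow>
    times_differentiable_on k S (\<lambda>x. H (F x))"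
proof (induction k arbitrary: H)
  case 0
  then show ?case using continuous_on_compose2 assms by auto
next
  case (Suc k)
  have d: "H differentiable (at (F x))" "F differentiable (at x)" if "x \<in> S" for x
    using that Suc.prems assms(3) unfolding times_differentiable_on_Suc by blast+
  show ?case
    unfolding times_differentiable_on_Suc
  proof (intro conjI allI ballI)
    fix x assume "x \<in> S"
    then show "(\<lambda>x. H (F x)) differentiable at x"
      using differentiable_chain_at[OF d(2,1)] by (simp add: o_def)
  next
    fix v
    have "times_differentiable_on k S (\<lambda>x. dir_deriv H (F x) w)" for w
      using Suc times_differentiable_on_Suc[of k T H] times_differentiable_on_SucD[of k S F] by blast
    then have "times_differentiable_on k S (\<lambda>x. dir_deriv H (F x) (dir_deriv F x v))"
      using Suc.prems(2) d(1) assms(1) times_differentiable_on_Suc[of k S F]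
      by (intro times_differentiable_on_linear_family[where L = "\<lambda>x. dir_deriv H (F x)"
            and X = "\<lambda>x. dir_deriv F x v"] linear_dir_deriv) blast+
    then show "times_differentiable_on k S (\<lambda>x. dir_deriv (\<lambda>x. H (F x)) x v)"
      by (subst times_differentiable_on_cong[OF assms(1)]) (simp_all add: dir_deriv_chain d)
  qed
qed

section \<open>Smooth maps and the Leibniz rule for families of linear maps\<close>

lemma smooth_on_D: "smooth_on S F \<Longrightarrow> times_differentiable_on k S F"
  by (simp add: smooth_on_def)

lemma smooth_on_differentiable: "smooth_on S F \<Longrightarrow> x \<in> S \<Longrightarrow> F differentiable (at x)"
  using smooth_on_D[of S F "Suc 0"] by (simp add: times_differentiable_on_Suc)

lemma smooth_on_continuous: "smooth_on S F \<Longrightarrow> continuous_on S F"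
  using times_differentiable_on_continuous smooth_on_D by blast

lemma smooth_on_cong:
  "open S \<Longrightarrow> (\<And>x. x \<in> S \<Longrightarrow> F x = H x) \<Longrightarrow> smooth_on S F \<longleftrightarrow> smooth_on S H"
  unfolding smooth_on_def using times_differentiable_on_cong by blast

lemma smooth_on_local:
  assumes "\<And>x. x \<in> S \<Longrightarrow> \<exists>U. open U \<and> x \<in> U \<and> smooth_on U F"
  shows "smooth_on S F"
  using assms times_differentiable_on_local unfolding smooth_on_def by metis

lemma smooth_on_const: "smooth_on S (\<lambda>_. c)"
  by (simp add: smooth_on_def times_differentiable_on_const)

lemma smooth_on_ident: "smooth_on S (\<lambda>x. x)"
  by (simp add: smooth_on_def times_differentiable_on_ident)

lemma smooth_on_add:
  "open S \<Longrightarrow> smooth_on S F \<Longrightarrow> smooth_on S H \<Longrightarrow> smooth_on S (\<lambda>x. F x + H x)"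
  by (simp add: smooth_on_def times_differentiable_on_add)

lemma smooth_on_bilinear:
  "open S \<Longrightarrow> bounded_bilinear B \<Longrightarrow> smooth_on S F \<Longrightarrow> smooth_on S H \<Longrightarrow>
    smooth_on S (\<lambda>x. B (F x) (H x))"
  by (simp add: smooth_on_def times_differentiable_on_bilinear)

lemma smooth_on_mult:
  fixes F :: "'a::euclidean_space \<Rightarrow> real"
  shows "open S \<Longrightarrow> smooth_on S F \<Longrightarrow> smooth_on S H \<Longrightarrow> smooth_on S (\<lambda>x. F x * H x)"
  by (simp add: smooth_on_def times_differentiable_on_mult)

lemma smooth_on_scaleR:
  "open S \<Longrightarrow> smooth_on S F \<Longrightarrow> smooth_on S H \<Longrightarrow> smooth_on S (\<lambda>x. F x *\<^sub>R H x)"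
  by (simp add: smooth_on_def times_differentiable_on_scaleR)

lemma smooth_on_linear:
  "open S \<Longrightarrow> bounded_linear L \<Longrightarrow> smooth_on S F \<Longrightarrow> smooth_on S (\<lambda>x. L (F x))"
  by (simp add: smooth_on_def times_differentiable_on_linear)

lemma smooth_on_diff:
  "open S \<Longrightarrow> smooth_on S F \<Longrightarrow> smooth_on S H \<Longrightarrow> smooth_on S (\<lambda>x. F x - H x)"
  by (simp add: smooth_on_def times_differentiable_on_diff)

lemma smooth_on_divide:
  fixes F :: "'a::euclidean_space \<Rightarrow> real"
  assumes "open S" "smooth_on S F" "smooth_on S H" "\<And>x. x \<in> S \<Longrightarrow> H x \<noteq> 0"
  shows "smooth_on S (\<lambda>x. F x / H x)"
  using assms by (simp add: divide_inverse smooth_on_def times_differentiable_on_mult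
      times_differentiable_on_inverse)

lemma smooth_on_sum:
  "open S \<Longrightarrow> (\<And>i. i \<in> I \<Longrightarrow> smooth_on S (F i)) \<Longrightarrow> smooth_on S (\<lambda>x. \<Sum>i\<in>I. F i x)"
  by (simp add: smooth_on_def times_differentiable_on_sum)

lemma smooth_on_linear_family:
  fixes L :: "'a::euclidean_space \<Rightarrow> 'b::euclidean_space \<Rightarrow> 'c::euclidean_space"
  assumes "open S" "\<And>x. x \<in> S \<Longrightarrow> linear (L x)" "\<And>v. smooth_on S (\<lambda>x. L x v)" "smooth_on S X"
  shows "smooth_on S (\<lambda>x. L x (X x))"
  using assms by (auto simp: smooth_on_def intro: times_differentiable_on_linear_family)

lemma smooth_on_compose:
  "open S \<Longrightarrow> open T \<Longrightarrow> F ` S \<subseteq> T \<Longrightarrow> smooth_on T H \<Longrightarrow> smooth_on S F \<Longrightarrow>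
    smooth_on S (\<lambda>x. H (F x))"
  by (simp add: smooth_on_def times_differentiable_on_compose[of S T F])

lemma smooth_on_dir_deriv_const: "smooth_on S F \<Longrightarrow> smooth_on S (\<lambda>x. dir_deriv F x v)"
  using times_differentiable_on_Suc unfolding smooth_on_def by blast

lemma smooth_on_dir_deriv:
  assumes "open S" "smooth_on S F" "smooth_on S X"
  shows "smooth_on S (\<lambda>x. dir_deriv F x (X x))"
  by (rule smooth_on_linear_family[OF assms(1) linear_dir_deriv
        smooth_on_dir_deriv_const[OF assms(2)] assms(3)])
    (rule smooth_on_differentiable[OF assms(2)])

text \<open>The identities that express linearity hold on a neighbourhood of \<open>x\<close>, so
  they can be differentiated at \<open>x\<close>.\<close>

lemma linear_dir_deriv_family:
  fixes L :: "'a::euclidean_space \<Rightarrow> 'b::real_vector \<Rightarrow> 'c::euclidean_space"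
  assumes "open S" "x \<in> S" "\<And>y. y \<in> S \<Longrightarrow> linear (L y)" "\<And>w. (\<lambda>y. L y w) differentiable (at x)"
  shows "linear (\<lambda>w. dir_deriv (\<lambda>y. L y w) x v)"
proof (rule linearI)
  fix u w :: 'b and c :: real
  have "dir_deriv (\<lambda>y. L y (u + w)) x v = dir_deriv (\<lambda>y. L y u + L y w) x v"
    using dir_deriv_cong_open[OF assms(1,2), of "\<lambda>y. L y (u + w)" "\<lambda>y. L y u + L y w"] assms(3)
    by (simp add: linear_add)
  then show "dir_deriv (\<lambda>y. L y (u + w)) x v = dir_deriv (\<lambda>y. L y u) x v + dir_deriv (\<lambda>y. L y w) x v"
    using dir_deriv_add[OF assms(4) assms(4)] by simp
  have "dir_deriv (\<lambda>y. L y (c *\<^sub>R u)) x v = dir_deriv (\<lambda>y. c *\<^sub>R L y u) x v"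
    using dir_deriv_cong_open[OF assms(1,2), of "\<lambda>y. L y (c *\<^sub>R u)" "\<lambda>y. c *\<^sub>R L y u"] assms(3)
    by (simp add: linear_scale)
  then show "dir_deriv (\<lambda>y. L y (c *\<^sub>R u)) x v = c *\<^sub>R dir_deriv (\<lambda>y. L y u) x v"
    using dir_deriv_linear[OF bounded_linear_scaleR_right assms(4)] by simp
qed

text \<open>The Leibniz rule for a linear map depending on the point. Since \<open>L\<close> is
  controlled only on fixed vectors, \<open>X y\<close> is first expanded in the standard
  basis.\<close>

lemma
  fixes L :: "'a::euclidean_space \<Rightarrow> 'b::euclidean_space \<Rightarrow> 'c::euclidean_space"
  assumes "open S" "x \<in> S" "\<And>y. y \<in> S \<Longrightarrow> linear (L y)" "\<And>w. (\<lambda>y. L y w) differentiable (at x)"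
    and X: "X differentiable (at x)"
  shows differentiable_linear_family: "(\<lambda>y. L y (X y)) differentiable (at x)"
    and dir_deriv_linear_family: "dir_deriv (\<lambda>y. L y (X y)) x v =
      dir_deriv (\<lambda>y. L y (X x)) x v + L x (dir_deriv X x v)"
proof -
  let ?D = "\<lambda>v. dir_deriv (\<lambda>y. L y (X x)) x v + L x (dir_deriv X x v)"
  have "((\<lambda>y. \<Sum>b\<in>Basis. (X y \<bullet> b) *\<^sub>R L y b) has_derivative
      (\<lambda>v. \<Sum>b\<in>Basis. (X x \<bullet> b) *\<^sub>R dir_deriv (\<lambda>y. L y b) x v + (dir_deriv X x v \<bullet> b) *\<^sub>R L x b)) (at x)"
    by (auto intro!: derivative_eq_intros has_dir_deriv[OF X] has_dir_deriv[OF assms(4)])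
  moreover have "(\<Sum>b\<in>Basis. (X x \<bullet> b) *\<^sub>R dir_deriv (\<lambda>y. L y b) x v + (dir_deriv X x v \<bullet> b) *\<^sub>R L x b) = ?D v"
    for v
    using linear_euclidean_expansion[OF linear_dir_deriv_family[OF assms(1-4), of v], of "X x"]
      linear_euclidean_expansion[OF assms(3)[OF assms(2)], of "dir_deriv X x v"]
    by (simp add: sum.distrib)
  ultimately have "((\<lambda>y. \<Sum>b\<in>Basis. (X y \<bullet> b) *\<^sub>R L y b) has_derivative ?D) (at x)"
    by simp
  then have "((\<lambda>y. L y (X y)) has_derivative ?D) (at x)"
    by (rule has_derivative_transform_within_open[OF _ assms(1,2)])
      (metis assms(3) linear_euclidean_expansion)
  then show "(\<lambda>y. L y (X y)) differentiable (at x)" "dir_deriv (\<lambda>y. L y (X y)) x v = ?D v"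
    by (auto intro: differentiableI simp: dir_deriv_eqI)
qed

section \<open>Inner products, traces and the musical isomorphism\<close>

text \<open>The algebra of a single tangent space: \<open>b\<close> will be the value
  \<open>g x\<close> of a metric at one point.\<close>

locale inner_form =
  fixes b :: "'a::euclidean_space \<Rightarrow> 'a \<Rightarrow> real"
  assumes bilinear: "bilinear b" and sym: "b u v = b v u" and pos: "u \<noteq> 0 \<Longrightarrow> b u u > 0"
begin

lemma linear_left: "linear (\<lambda>u. b u v)" and linear_right: "linear (b u)"
  using bilinear by (auto simp: bilinear_def)

lemma eqI:
  assumes "\<And>z. b u z = b v z"
  shows "u = v"
proof -
  have "b (u - v) (u - v) = 0"
    using assms by (simp add: bilinear_lsub[OF bilinear])
  then show ?thesis using pos[of "u - v"] by fastforce
qed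

lemma ex_sharp:
  assumes "linear l"
  shows "\<exists>w. \<forall>z. b w z = l z"
proof -
  \<comment> \<open>\<open>T\<close> represents \<open>b\<close> with respect to the standard inner
    product; definiteness makes it injective, hence surjective by dimension.\<close>
  define T where "T w = (\<Sum>i\<in>Basis. b w i *\<^sub>R i)" for w
  have T: "T w \<bullet> z = b w z" for w z
    using linear_euclidean_expansion[OF linear_right, of w z]
    by (simp add: T_def inner_Basis_sum)
  have lin: "linear T"
    unfolding T_def using linear_left by (auto intro!: linearI simp: linear_add linear_scale
        scaleR_add_left sum.distrib scaleR_sum_right bilinear_ladd[OF bilinear] bilinear_lmul[OF bilinear])
  have "inj T"
  proof (rule injI)
    fix u v assume "T u = T v"
    then have "b u z = b v z" for z using T by metis
    then show "u = v" by (rule eqI)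
  qed
  then obtain w where w: "T w = (\<Sum>i\<in>Basis. l i *\<^sub>R i)"
    using linear_injective_imp_surjective[OF lin] by (metis surjD)
  have "b w z = l z" for z
    using linear_euclidean_expansion[OF assms, of z] T[of w z]
    by (simp add: w inner_Basis_sum)
  then show ?thesis by blast
qed

lemma sharp_eqI: "(\<And>z. b w z = l z) \<Longrightarrow> sharp b l = w"
  unfolding sharp_def by (rule the_equality) (auto intro: eqI)

lemma sharp: "linear l \<Longrightarrow> b (sharp b l) z = l z"
  using ex_sharp sharp_eqI by metis

lemma linear_sharp:
  assumes "\<And>u. linear (F u)" "\<And>z. linear (\<lambda>u. F u z)"
  shows "linear (\<lambda>u. sharp b (F u))"
  by (rule linearI; rule sharp_eqI)
    (use assms in \<open>simp_all add: bilinear_ladd[OF bilinear] bilinear_lmul[OF bilinear] sharp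
      linear_add[OF assms(2)] linear_scale[OF assms(2)]\<close>)

lemma orthonormal_coeff:
  assumes "finite E" "\<And>u v. u \<in> E \<Longrightarrow> v \<in> E \<Longrightarrow> b u v = (if u = v then 1 else 0)" "v \<in> E"
  shows "b (\<Sum>e\<in>E. c e *\<^sub>R e) v = c v"
proof -
  have "b (\<Sum>e\<in>E. c e *\<^sub>R e) v = (\<Sum>e\<in>E. c e * b e v)"
    by (simp add: linear_sum[OF linear_left] linear_scale[OF linear_left])
  also have "\<dots> = (\<Sum>e\<in>E. if e = v then c e else 0)"
    using assms by (intro sum.cong) auto
  finally show ?thesis using assms by simp
qed

lemma orthonormal_independent:
  assumes "finite E" "\<And>u v. u \<in> E \<Longrightarrow> v \<in> E \<Longrightarrow> b u v = (if u = v then 1 else 0)"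
  shows "independent E"
proof (rule independent_if_scalars_zero[OF assms(1)])
  fix c v assume "(\<Sum>e\<in>E. c e *\<^sub>R e) = 0" "v \<in> E"
  then show "c v = 0"
    using orthonormal_coeff[OF assms, of v c] by (simp add: linear_0[OF linear_left])
qed

text \<open>\<open>frame_sum\<close> chooses its basis by \<open>SOME\<close>, so existence has to
  be secured. An orthonormal family of maximal cardinality must span, since otherwise a Gram-Schmidt
  step enlarges it.\<close>

lemma ex_orthonormal_basis: "\<exists>E. orthonormal_basis b E"
proof -
  define Q where "Q E \<longleftrightarrow> finite E \<and> (\<forall>u\<in>E. \<forall>v\<in>E. b u v = (if u = v then 1 else 0))" for E
  have ind: "independent E" if "Q E" for E
    using that orthonormal_independent unfolding Q_def by blast
  have le: "card E \<le> DIM('a)" if "Q E" for E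
    using ind[OF that] independent_bound by blast
  have "Q {}" by (simp add: Q_def)
  then obtain E where E: "Q E" and max: "\<And>E'. Q E' \<Longrightarrow> card E' \<le> card E"
    using ex_has_greatest_nat[of Q "{}" card "Suc DIM('a)"] le by (metis less_Suc_eq_le)
  then have fin: "finite E" and on: "\<And>u v. u \<in> E \<Longrightarrow> v \<in> E \<Longrightarrow> b u v = (if u = v then 1 else 0)"
    by (auto simp: Q_def)
  have "span E = UNIV"
  proof (rule ccontr)
    assume "span E \<noteq> UNIV"
    then obtain x where x: "x \<notin> span E" by blast
    define y where "y = x - (\<Sum>e\<in>E. b x e *\<^sub>R e)"
    have "(\<Sum>e\<in>E. b x e *\<^sub>R e) \<in> span E"
      by (intro span_sum span_scale span_base)
    then have "y \<noteq> 0" using x by (auto simp: y_def)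
    then have yy: "b y y > 0" by (rule pos)
    have ye: "b y e = 0" if "e \<in> E" for e
      using orthonormal_coeff[OF fin on that, of "b x"] by (simp add: y_def bilinear_lsub[OF bilinear])
    define w where "w = (1 / sqrt (b y y)) *\<^sub>R y"
    have ww: "b w w = 1"
      using yy by (simp add: w_def bilinear_lmul[OF bilinear] bilinear_rmul[OF bilinear]
          real_sqrt_mult[symmetric] field_simps)
    have we: "b w e = 0" "b e w = 0" if "e \<in> E" for e
      using ye[OF that] sym[of e w] by (simp_all add: w_def bilinear_lmul[OF bilinear])
    have "w \<notin> E" using ww we by fastforce
    moreover have "Q (insert w E)"
      unfolding Q_def using fin on ww we \<open>w \<notin> E\<close>
      by (metis finite_insert insert_iff)
    ultimately show False using max[of "insert w E"] fin by simp
  qed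
  then have "card E = DIM('a)"
    using ind[OF E] dim_eq_card_independent[of E] dim_span[of E] by simp
  then show ?thesis using fin on unfolding orthonormal_basis_def by blast
qed

lemma orthonormal_basis_expansion:
  assumes "orthonormal_basis b E"
  shows "(\<Sum>e\<in>E. b u e *\<^sub>R e) = u"
proof -
  have fin: "finite E" and card: "card E = DIM('a)"
    and on: "\<And>u v. u \<in> E \<Longrightarrow> v \<in> E \<Longrightarrow> b u v = (if u = v then 1 else 0)"
    using assms by (auto simp: orthonormal_basis_def)
  have "span E = UNIV"
    using card_ge_dim_independent[of E UNIV] orthonormal_independent[OF fin on] card by auto
  have "b (\<Sum>e\<in>E. b u e *\<^sub>R e) e = b u e" if "e \<in> E" for e
    using orthonormal_coeff[OF fin on that] .
  then have "b (\<Sum>e\<in>E. b u e *\<^sub>R e) z = b u z" for z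
    using linear_eq_on_span[OF linear_right linear_right, of E _ u z] \<open>span E = UNIV\<close> by blast
  then show ?thesis by (rule eqI)
qed

lemma frame_sum_basis: "\<exists>E. orthonormal_basis b E \<and> (\<forall>F. frame_sum b F = (\<Sum>e\<in>E. F e))"
  unfolding frame_sum_def using someI_ex[OF ex_orthonormal_basis] by blast

lemma frame_sum_add: "frame_sum b (\<lambda>e. F e + H e) = frame_sum b F + frame_sum b H"
  and frame_sum_diff: "frame_sum b (\<lambda>e. F e - H e) = frame_sum b F - frame_sum b H"
  and frame_sum_mult: "frame_sum b (\<lambda>e. c * F e) = c * frame_sum b F"
  and frame_sum_0: "frame_sum b (\<lambda>e. 0) = 0"
  by (simp_all add: frame_sum_def sum.distrib sum_subtractf sum_distrib_left)

lemma frame_sum_swap: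
  "frame_sum b (\<lambda>u. frame_sum b (K u)) = frame_sum b (\<lambda>v. frame_sum b (\<lambda>u. K u v))"
  unfolding frame_sum_def by (rule sum.swap)

lemma frame_sum_form [simp]: "frame_sum b (\<lambda>e. b e e) = real DIM('a)"
proof -
  obtain E where E: "orthonormal_basis b E" "\<forall>F. frame_sum b F = (\<Sum>e\<in>E. F e)"
    using frame_sum_basis by blast
  then show ?thesis by (simp add: orthonormal_basis_def)
qed

text \<open>The contraction that turns (X\<mu>) g into d\<mu> in the divergence; it also evaluates
  the trace of the square of \<omega> and the mixed terms of the Kulkarni-Nomizu product.\<close>

lemma frame_sum_contract:
  assumes "linear l"
  shows "frame_sum b (\<lambda>e. l e * b e z) = l z"
proof -
  obtain E where E: "orthonormal_basis b E" "\<forall>F. frame_sum b F = (\<Sum>e\<in>E. F e)"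
    using frame_sum_basis by blast
  have "l z = l (\<Sum>e\<in>E. b z e *\<^sub>R e)"
    using orthonormal_basis_expansion[OF E(1)] by simp
  also have "\<dots> = (\<Sum>e\<in>E. l e * b e z)"
    using assms sym[of z] by (simp add: linear_sum linear_scale mult.commute)
  finally show ?thesis using E(2) by simp
qed

text \<open>Unlike the orthonormal basis chosen by \<open>frame_sum\<close>, the right-hand side depends smoothly on \<open>b\<close>.\<close>

lemma frame_sum_eq_trace_sharp:
  assumes F: "\<And>u. linear (F u)" "\<And>z. linear (\<lambda>u. F u z)"
  shows "frame_sum b (\<lambda>e. F e e) = (\<Sum>i\<in>Basis. sharp b (F i) \<bullet> i)"
proof -
  obtain E where E: "orthonormal_basis b E" "\<forall>F. frame_sum b F = (\<Sum>e\<in>E. F e)"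
    using frame_sum_basis by blast
  define L where "L u = sharp b (F u)" for u
  have lin: "linear L" unfolding L_def using linear_sharp[OF F] .
  have "(\<Sum>i\<in>Basis. L i \<bullet> i) = (\<Sum>i\<in>Basis. L (\<Sum>e\<in>E. b i e *\<^sub>R e) \<bullet> i)"
    using orthonormal_basis_expansion[OF E(1)] by simp
  also have "\<dots> = (\<Sum>i\<in>Basis. \<Sum>e\<in>E. b i e * (L e \<bullet> i))"
    by (simp add: linear_sum[OF lin] linear_scale[OF lin] inner_sum_left)
  also have "\<dots> = (\<Sum>e\<in>E. \<Sum>i\<in>Basis. b i e * (L e \<bullet> i))"
    by (rule sum.swap)
  also have "\<dots> = (\<Sum>e\<in>E. b (L e) e)"
  proof (rule sum.cong[OF refl])
    fix e
    show "(\<Sum>i\<in>Basis. b i e * (L e \<bullet> i)) = b (L e) e"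
      using linear_euclidean_expansion[OF linear_left, of "L e" e] by (simp add: mult.commute)
  qed
  also have "\<dots> = (\<Sum>e\<in>E. F e e)"
    by (simp add: L_def sharp F)
  finally show ?thesis by (simp add: L_def E(2))
qed

text \<open>This is tr(LM) = tr(ML) for the endomorphism L obtained from \<open>F\<close> by raising
  an index. It will move a Christoffel endomorphism from one side to the other.\<close>

lemma frame_sum_commute:
  assumes F: "\<And>u. linear (F u)" "\<And>z. linear (\<lambda>u. F u z)" and M: "linear M"
  shows "frame_sum b (\<lambda>e. F (M e) e) = frame_sum b (\<lambda>e. b (M (sharp b (F e))) e)"
proof -
  obtain E where E: "orthonormal_basis b E" "\<forall>F. frame_sum b F = (\<Sum>e\<in>E. F e)"
    using frame_sum_basis by blast
  define L where "L u = sharp b (F u)" for u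
  have lin: "linear L" unfolding L_def using linear_sharp[OF F] .
  have "(\<Sum>e\<in>E. b (L (M e)) e) = (\<Sum>e\<in>E. b (L (\<Sum>d\<in>E. b (M e) d *\<^sub>R d)) e)"
    using orthonormal_basis_expansion[OF E(1)] by simp
  also have "\<dots> = (\<Sum>e\<in>E. \<Sum>d\<in>E. b (M e) d * b (L d) e)"
    by (simp add: linear_sum[OF lin] linear_scale[OF lin] linear_sum[OF linear_left] linear_scale[OF linear_left])
  also have "\<dots> = (\<Sum>d\<in>E. \<Sum>e\<in>E. b (M e) d * b (L d) e)"
    by (rule sum.swap)
  also have "\<dots> = (\<Sum>d\<in>E. b (M (\<Sum>e\<in>E. b (L d) e *\<^sub>R e)) d)"
    by (simp add: linear_sum[OF M] linear_scale[OF M] linear_sum[OF linear_left] linear_scale[OF linear_left] mult.commute)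
  finally show ?thesis
    unfolding orthonormal_basis_expansion[OF E(1)] by (simp add: L_def E(2) sharp F)
qed

end

section \<open>Smooth metrics on an open set and smoothness of the musical isomorphism\<close>

locale metric_on =
  fixes S :: "'a::euclidean_space set" and g :: "'a metric"
  assumes open_S: "open S"
    and inner_form: "x \<in> S \<Longrightarrow> inner_form (g x)"
    and smooth: "smooth_on S (\<lambda>x. g x u v)"
begin

lemma linear_metric:
  assumes "x \<in> S"
  shows "linear (\<lambda>u. g x u v)" "linear (g x u)"
  using inner_form.linear_left[OF inner_form] inner_form.linear_right[OF inner_form] assms by blast+

text \<open>The inverse function theorem for \<open>\<Phi>\<close>, which sends a pair (point,
  vector) to (point, covector) by lowering the index; its inverse \<open>\<Psi>\<close> is built
  from \<open>sharp\<close>. Treating point and covector as joint variables gives differentiability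
  and continuity at once.\<close>

lemma sharp_joint_differentiable:
  assumes "x \<in> S"
  shows "(\<lambda>p. sharp (g (fst p)) (\<lambda>z. snd p \<bullet> z)) differentiable (at (x, m))"
proof -
  interpret gx: inner_form "g x" using inner_form[OF assms] .
  define \<Phi> where "\<Phi> p = (fst p, \<Sum>i\<in>Basis. (\<Sum>j\<in>Basis. (snd p \<bullet> j) * g (fst p) j i) *\<^sub>R i)"
    for p :: "'a \<times> 'a"
  define \<Psi> where "\<Psi> p = (fst p, sharp (g (fst p)) (\<lambda>z. snd p \<bullet> z))" for p :: "'a \<times> 'a"
  define \<Phi>' where "\<Phi>' p h = (fst h, \<Sum>i\<in>Basis. (\<Sum>j\<in>Basis. (snd p \<bullet> j) * dir_deriv (\<lambda>y. g y j i) (fst p) (fst h)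
      + (snd h \<bullet> j) * g (fst p) j i) *\<^sub>R i)" for p h :: "'a \<times> 'a"
  have snd_\<Phi>: "snd (\<Phi> p) \<bullet> z = g (fst p) (snd p) z" if "fst p \<in> S" for p z
  proof -
    interpret inner_form "g (fst p)" using inner_form[OF that] .
    have "snd (\<Phi> p) = (\<Sum>i\<in>Basis. g (fst p) (snd p) i *\<^sub>R i)"
      using linear_euclidean_expansion[OF linear_left, of "snd p"] by (simp add: \<Phi>_def)
    then show ?thesis
      using linear_euclidean_expansion[OF linear_right, of "snd p" z]
      by (simp add: inner_Basis_sum)
  qed
  have \<Psi>\<Phi>: "\<Psi> (\<Phi> p) = p" if "p \<in> S \<times> UNIV" for p
  proof -
    interpret inner_form "g (fst p)" using inner_form that by auto
    have "sharp (g (fst p)) (\<lambda>z. snd (\<Phi> p) \<bullet> z) = snd p"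
      by (rule sharp_eqI) (use that snd_\<Phi>[of p] in auto)
    then show ?thesis by (simp add: \<Psi>_def prod_eq_iff) (simp add: \<Phi>_def)
  qed
  have der: "(\<Phi> has_derivative \<Phi>' p) (at p)" if "p \<in> S \<times> UNIV" for p
  proof -
    have "((\<lambda>p. g (fst p) j i) has_derivative (\<lambda>h. dir_deriv (\<lambda>y. g y j i) (fst p) (fst h))) (at p)" for i j
    proof -
      have "((\<lambda>y. g y j i) has_derivative dir_deriv (\<lambda>y. g y j i) (fst p)) (at (fst p))"
        using that smooth by (intro has_dir_deriv smooth_on_differentiable[of S]) auto
      then show ?thesis
        by (rule has_derivative_compose[OF has_derivative_fst[OF has_derivative_ident]])
    qed
    then show ?thesis
      unfolding \<Phi>_def \<Phi>'_def by (auto intro!: derivative_eq_intros)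
  qed
  define w where "w = sharp (g x) (\<lambda>z. m \<bullet> z)"
  have lin_m: "linear (\<lambda>z. m \<bullet> z)"
    by (simp add: linear_iff inner_add_right)
  have "snd (\<Phi> (x, w)) \<bullet> z = m \<bullet> z" for z
    using snd_\<Phi>[of "(x, w)" z] assms gx.sharp[OF lin_m] by (simp add: w_def)
  then have \<Phi>w: "\<Phi> (x, w) = (x, m)"
    by (metis (no_types, lifting) \<Phi>_def fst_conv prod.collapse vector_eq_rdot)
  have lin: "linear (\<Phi>' (x, w))"
    using der[of "(x, w)"] assms has_derivative_linear by blast
  \<comment> \<open>The derivative is block triangular, with the identity on base points and the
    nondegenerate form \<open>g x\<close> on vectors.\<close>
  have "inj (\<Phi>' (x, w))"
    unfolding linear_injective_0[OF lin]
  proof (intro allI impI)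
    fix h assume 0: "\<Phi>' (x, w) h = 0"
    then have h1: "fst h = 0" by (simp add: \<Phi>'_def zero_prod_def)
    then have "dir_deriv (\<lambda>y. g y j i) x (fst h) = 0" for i j
      using linear_0[OF linear_dir_deriv[OF smooth_on_differentiable[OF smooth assms]]] by simp
    with 0 have "snd (\<Phi> (x, snd h)) = 0" by (simp add: \<Phi>'_def \<Phi>_def zero_prod_def)
    then have "g x (snd h) z = g x 0 z" for z
      using snd_\<Phi>[of "(x, snd h)" z] assms by (simp add: linear_0[OF gx.linear_left])
    then have "snd h = 0" by (rule gx.eqI)
    with h1 show "h = 0" by (simp add: prod_eq_iff)
  qed
  then obtain g' where "\<And>h. \<Phi>' (x, w) (g' h) = h"
    using linear_injective_isomorphism[OF lin] by blast
  then have id: "\<Phi>' (x, w) \<circ> g' = id" by auto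
  have "(\<Psi> has_derivative g') (at (\<Phi> (x, w)))"
  proof (rule has_derivative_inverse_strong[where S = "S \<times> UNIV" and f = \<Phi> and x = "(x, w)" and f' = "\<Phi>' (x, w)"])
    show "open (S \<times> (UNIV :: 'a set))" by (simp add: open_S open_Times)
    show "(x, w) \<in> S \<times> UNIV" using assms by simp
    show "continuous_on (S \<times> UNIV) \<Phi>"
      by (rule continuous_at_imp_continuous_on) (use der has_derivative_continuous in blast)
    show "(\<Phi> has_derivative \<Phi>' (x, w)) (at (x, w))" using der assms by simp
  qed (fact \<Psi>\<Phi> id)+
  then have "(\<lambda>p. snd (\<Psi> p)) differentiable (at (x, m))"
    unfolding \<Phi>w by (metis differentiableI has_derivative_snd)
  then show ?thesis by (simp add: \<Psi>_def)
qed

text \<open>Identifies a linear form with its coordinate vector, which is the covector variable of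
  \<open>sharp_joint_differentiable\<close>.\<close>

lemma sharp_coordinates:
  assumes "linear (l :: 'a \<Rightarrow> real)"
  shows "sharp (g y) l = sharp (g y) (\<lambda>z. (\<Sum>i\<in>Basis. l i *\<^sub>R i) \<bullet> z)"
proof (rule arg_cong[of l], rule ext)
  fix z
  show "l z = (\<Sum>i\<in>Basis. l i *\<^sub>R i) \<bullet> z"
    using linear_euclidean_expansion[OF assms, of z] by (simp add: inner_Basis_sum)
qed

lemma sharp_differentiable:
  assumes "x \<in> S" "\<And>y. y \<in> S \<Longrightarrow> linear (l y)" "\<And>z. (\<lambda>y. l y z) differentiable (at x)"
  shows "(\<lambda>y. sharp (g y) (l y)) differentiable (at x)"
proof -
  let ?L = "\<lambda>y. \<Sum>i\<in>Basis. l y i *\<^sub>R i"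
  have "?L differentiable (at x)"
    using assms(3) by simp
  then have "(\<lambda>y. (y, ?L y)) differentiable (at x)"
    using has_derivative_Pair[OF has_derivative_ident] unfolding differentiable_def by blast
  from differentiable_chain_at[OF this sharp_joint_differentiable[OF assms(1)]]
  obtain D where "((\<lambda>y. sharp (g y) (\<lambda>z. ?L y \<bullet> z)) has_derivative D) (at x)"
    unfolding differentiable_def o_def by auto
  then have "((\<lambda>y. sharp (g y) (l y)) has_derivative D) (at x)"
    by (rule has_derivative_transform_within_open[OF _ open_S assms(1)])
      (rule sharp_coordinates[OF assms(2), symmetric])
  then show ?thesis by (rule differentiableI)
qed

text \<open>Joint differentiability of \<open>sharp\<close> yields joint continuity, which can be
  composed with a merely continuous \<open>l\<close>. This starts the induction for higher
  orders.\<close>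

lemma sharp_continuous:
  assumes "\<And>y. y \<in> S \<Longrightarrow> linear (l y)" "\<And>z. continuous_on S (\<lambda>y. l y z)"
  shows "continuous_on S (\<lambda>y. sharp (g y) (l y))"
proof -
  let ?L = "\<lambda>y. \<Sum>i\<in>Basis. l y i *\<^sub>R i"
  have "continuous_on (S \<times> UNIV) (\<lambda>p. sharp (g (fst p)) (\<lambda>z. snd p \<bullet> z))"
    by (rule continuous_at_imp_continuous_on)
      (auto intro!: differentiable_imp_continuous_within sharp_joint_differentiable)
  moreover have "continuous_on S (\<lambda>y. (y, ?L y))"
    by (intro continuous_intros assms)
  ultimately have "continuous_on S (\<lambda>y. sharp (g (fst (y, ?L y))) (\<lambda>z. snd (y, ?L y) \<bullet> z))"
    by (rule continuous_on_compose2) auto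
  then have "continuous_on S (\<lambda>y. sharp (g y) (\<lambda>z. ?L y \<bullet> z))"
    by simp
  moreover have "sharp (g y) (l y) = sharp (g y) (\<lambda>z. ?L y \<bullet> z)" if "y \<in> S" for y
    using sharp_coordinates assms(1)[OF that] .
  ultimately show ?thesis by (simp cong: continuous_on_cong)
qed

lemma metric_differentiable: "x \<in> S \<Longrightarrow> (\<lambda>y. g y u v) differentiable (at x)"
  by (rule smooth_on_differentiable[OF smooth])

lemma dir_deriv_metric_right:
  assumes "x \<in> S" "Y differentiable (at x)"
  shows "(\<lambda>y. g y u (Y y)) differentiable (at x)"
    "dir_deriv (\<lambda>y. g y u (Y y)) x v = dir_deriv (\<lambda>y. g y u (Y x)) x v + g x u (dir_deriv Y x v)"
proof -
  show "(\<lambda>y. g y u (Y y)) differentiable (at x)"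
    by (rule differentiable_linear_family[where L = "\<lambda>y. g y u" and X = Y and S = S];
      simp add: open_S assms linear_metric metric_differentiable)
  show "dir_deriv (\<lambda>y. g y u (Y y)) x v = dir_deriv (\<lambda>y. g y u (Y x)) x v + g x u (dir_deriv Y x v)"
    by (rule dir_deriv_linear_family[where L = "\<lambda>y. g y u" and X = Y and S = S];
      simp add: open_S assms linear_metric metric_differentiable)
qed

lemma dir_deriv_metric:
  assumes "x \<in> S" "X differentiable (at x)" "Y differentiable (at x)"
  shows "(\<lambda>y. g y (X y) (Y y)) differentiable (at x)"
    "dir_deriv (\<lambda>y. g y (X y) (Y y)) x v = dir_deriv (\<lambda>y. g y (X x) (Y x)) x v
      + g x (dir_deriv X x v) (Y x) + g x (X x) (dir_deriv Y x v)"
proof -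
  have lin: "linear (\<lambda>u. g y u (Y y))" if "y \<in> S" for y
    using linear_metric(1)[OF that] .
  note * = open_S assms(1) lin dir_deriv_metric_right(1)[OF assms(1,3)] assms(2)
  show "(\<lambda>y. g y (X y) (Y y)) differentiable (at x)"
    by (rule differentiable_linear_family[where L = "\<lambda>y u. g y u (Y y)", OF *])
  show "dir_deriv (\<lambda>y. g y (X y) (Y y)) x v = dir_deriv (\<lambda>y. g y (X x) (Y x)) x v
      + g x (dir_deriv X x v) (Y x) + g x (X x) (dir_deriv Y x v)"
    using dir_deriv_linear_family[where L = "\<lambda>y u. g y u (Y y)", OF *, of v] dir_deriv_metric_right(2)[OF assms(1,3), of "X x" v]
    by linarith
qed

text \<open>Obtained by differentiating the defining relation of \<open>sharp\<close>. The
  right-hand side is again a linear form in \<open>z\<close>, so the derivative of a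
  \<open>sharp\<close> is itself a \<open>sharp\<close>.\<close>

lemma dir_deriv_sharp:
  assumes "x \<in> S" "\<And>y. y \<in> S \<Longrightarrow> linear (l y)" "\<And>z. (\<lambda>y. l y z) differentiable (at x)"
  shows "g x (dir_deriv (\<lambda>y. sharp (g y) (l y)) x v) z =
    dir_deriv (\<lambda>y. l y z) x v - dir_deriv (\<lambda>y. g y (sharp (g x) (l x)) z) x v"
proof -
  have "dir_deriv (\<lambda>y. g y (sharp (g y) (l y)) z) x v = dir_deriv (\<lambda>y. l y z) x v"
    by (rule arg_cong[where f = "\<lambda>F. F v"], rule dir_deriv_cong_open[OF open_S assms(1)])
      (rule inner_form.sharp[OF inner_form assms(2)])
  then show ?thesis
    using dir_deriv_metric(2)[OF assms(1) sharp_differentiable[OF assms] differentiable_const[of z], of v]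
      linear_0[OF linear_metric(2)[OF assms(1)]] by simp
qed

text \<open>A bootstrap on \<open>dir_deriv_sharp\<close>: the form \<open>m\<close> representing
  the derivative contains \<open>sharp (g y) (l y)\<close> undifferentiated, so \<open>k\<close>
  orders for the latter give \<open>k\<close> orders for \<open>m\<close>. The induction ranges over
  all forms because it is applied to both \<open>l\<close> and \<open>m\<close>.\<close>

lemma times_differentiable_on_sharp:
  "(\<And>y. y \<in> S \<Longrightarrow> linear (l y)) \<Longrightarrow> (\<And>z. times_differentiable_on k S (\<lambda>y. l y z)) \<Longrightarrow>
    times_differentiable_on k S (\<lambda>y. sharp (g y) (l y))"
proof (induction k arbitrary: l)
  case 0
  then show ?case by (simp add: sharp_continuous)
next
  case (Suc k)
  have dl: "(\<lambda>y. l y z) differentiable (at x)" if "x \<in> S" for x z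
    using Suc.prems(2)[of z] that times_differentiable_on_Suc by blast
  let ?W = "\<lambda>y. sharp (g y) (l y)"
  have W: "times_differentiable_on k S ?W"
    by (rule Suc.IH[OF Suc.prems(1) times_differentiable_on_SucD[OF Suc.prems(2)]])
  show ?case
    unfolding times_differentiable_on_Suc
  proof (intro conjI ballI allI)
    fix x assume "x \<in> S"
    then show "?W differentiable at x"
      by (intro sharp_differentiable[where l = l] Suc.prems(1) dl)
  next
    fix v
    define m where "m y z = dir_deriv (\<lambda>y. l y z) y v - dir_deriv (\<lambda>x. g x (?W y) z) y v" for y z
    have "linear (\<lambda>z. dir_deriv (\<lambda>y. l y z) x v)" if "x \<in> S" for x
      by (rule linear_dir_deriv_family[where L = l, OF open_S that Suc.prems(1) dl[OF that]])
    moreover have lin_dg: "linear (\<lambda>z. dir_deriv (\<lambda>y. g y w z) x v)"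
      "linear (\<lambda>w. dir_deriv (\<lambda>y. g y w z) x v)" if "x \<in> S" for x w z
      by (rule linear_dir_deriv_family[where L = "\<lambda>y z. g y w z", OF open_S that],
          erule linear_metric, rule metric_differentiable[OF that])
        (rule linear_dir_deriv_family[where L = "\<lambda>y w. g y w z", OF open_S that],
          erule linear_metric, rule metric_differentiable[OF that])
    ultimately have lin: "linear (m x)" if "x \<in> S" for x
      unfolding m_def using that by (intro linear_compose_sub) auto
    have m: "times_differentiable_on k S (\<lambda>y. m y z)" for z
    proof -
      have "times_differentiable_on k S (\<lambda>y. dir_deriv (\<lambda>x. g x (?W y) z) y v)"
        by (rule times_differentiable_on_linear_family[where
              L = "\<lambda>y w. dir_deriv (\<lambda>x. g x w z) y v", OF open_S lin_dg(2)
              smooth_on_D[OF smooth_on_dir_deriv_const[OF smooth]] W])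
      moreover have "times_differentiable_on k S (\<lambda>y. dir_deriv (\<lambda>y. l y z) y v)"
        using Suc.prems(2)[of z] times_differentiable_on_Suc by blast
      ultimately show ?thesis
        unfolding m_def by (intro times_differentiable_on_diff open_S)
    qed
    have "times_differentiable_on k S (\<lambda>y. sharp (g y) (m y))"
      by (rule Suc.IH, erule lin, rule m)
    moreover have "dir_deriv ?W y v = sharp (g y) (m y)" if "y \<in> S" for y
    proof -
      interpret inner_form "g y" using inner_form[OF that] .
      show ?thesis
        by (rule sharp_eqI[symmetric], unfold m_def)
          (rule dir_deriv_sharp[where l = l, OF that Suc.prems(1) dl[OF that]])
    qed
    ultimately show "times_differentiable_on k S (\<lambda>y. dir_deriv ?W y v)"
      using times_differentiable_on_cong[OF open_S, of "\<lambda>y. dir_deriv ?W y v" "\<lambda>y. sharp (g y) (m y)" k]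
      by blast
  qed
qed

lemma smooth_on_sharp:
  "(\<And>y. y \<in> S \<Longrightarrow> linear (l y)) \<Longrightarrow> (\<And>z. smooth_on S (\<lambda>y. l y z)) \<Longrightarrow>
    smooth_on S (\<lambda>y. sharp (g y) (l y))"
  unfolding smooth_on_def by (intro allI times_differentiable_on_sharp[where l = l]) blast+

lemma smooth_on_metric:
  assumes "smooth_on S X" "smooth_on S Y"
  shows "smooth_on S (\<lambda>y. g y (X y) (Y y))"
proof (rule smooth_on_linear_family[where L = "\<lambda>y u. g y u (Y y)", OF open_S _ _ assms(1)])
  show "smooth_on S (\<lambda>y. g y u (Y y))" for u
    by (rule smooth_on_linear_family[where L = "\<lambda>y. g y u", OF open_S _ smooth assms(2)])
      (rule linear_metric(2))
qed (rule linear_metric(1))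

text \<open>The chosen frames need not vary continuously with the point; the trace of
  \<open>sharp\<close> computes the same number by a formula that does vary smoothly.\<close>

lemma smooth_on_frame_sum:
  assumes "\<And>y u. y \<in> S \<Longrightarrow> linear (F y u)" "\<And>y z. y \<in> S \<Longrightarrow> linear (\<lambda>u. F y u z)"
    and "\<And>u z. smooth_on S (\<lambda>y. F y u z)"
  shows "smooth_on S (\<lambda>y. frame_sum (g y) (\<lambda>e. F y e e))"
proof -
  have "smooth_on S (\<lambda>y. \<Sum>i\<in>Basis. sharp (g y) (F y i) \<bullet> i)"
    by (intro smooth_on_sum[OF open_S] smooth_on_linear[OF open_S bounded_linear_inner_left]
        smooth_on_sharp[where l = "\<lambda>y. F y _"] assms)
  then show ?thesis
    using smooth_on_cong[OF open_S, of "\<lambda>y. frame_sum (g y) (\<lambda>e. F y e e)"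
        "\<lambda>y. \<Sum>i\<in>Basis. sharp (g y) (F y i) \<bullet> i"]
      inner_form.frame_sum_eq_trace_sharp[OF inner_form, of _ "F _"] assms(1,2)
    by blast
qed

end

section \<open>The Levi-Civita connection and Lie derivatives in a chart\<close>

lemma DERIV_along_line:
  fixes F :: "'a::euclidean_space \<Rightarrow> real"
  assumes "F differentiable (at (x + s *\<^sub>R u))"
  shows "((\<lambda>s. F (x + s *\<^sub>R u)) has_real_derivative dir_deriv F (x + s *\<^sub>R u) u) (at s)"
proof -
  have "((\<lambda>s. x + s *\<^sub>R u) has_derivative (\<lambda>h. h *\<^sub>R u)) (at s)"
    by (auto intro!: derivative_eq_intros)
  from has_derivative_compose[OF this has_dir_deriv[OF assms]]
  show ?thesis
    unfolding has_field_derivative_def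
    by (rule has_derivative_eq_rhs)
      (simp add: fun_eq_iff linear_scale[OF linear_dir_deriv[OF assms]] mult.commute)
qed

text \<open>Two applications of the mean value theorem, first along \<open>u\<close> and then along
  \<open>v\<close>. The second difference on the left is symmetric in \<open>u\<close> and
  \<open>v\<close>, which makes it the link between the two orders of differentiation.\<close>

lemma second_difference_mean_value:
  fixes F :: "'a::euclidean_space \<Rightarrow> real"
  assumes F: "smooth_on S F" and "h > 0"
    and S: "\<And>s t. 0 \<le> s \<Longrightarrow> s \<le> h \<Longrightarrow> 0 \<le> t \<Longrightarrow> t \<le> h \<Longrightarrow> x + s *\<^sub>R u + t *\<^sub>R v \<in> S"
  shows "\<exists>s t. 0 < s \<and> s < h \<and> 0 < t \<and> t < h \<and>
    F (x + h *\<^sub>R u + h *\<^sub>R v) - F (x + h *\<^sub>R u) - F (x + h *\<^sub>R v) + F x =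
     h * h * dir_deriv (\<lambda>y. dir_deriv F y u) (x + s *\<^sub>R u + t *\<^sub>R v) v"
proof -
  have "((\<lambda>s. F ((x + h *\<^sub>R v) + s *\<^sub>R u) - F (x + s *\<^sub>R u)) has_real_derivative
      (dir_deriv F ((x + h *\<^sub>R v) + s *\<^sub>R u) u - dir_deriv F (x + s *\<^sub>R u) u)) (at s)"
    if "0 \<le> s" "s \<le> h" for s
    using S[of s h] S[of s 0] that \<open>h > 0\<close>
    by (intro DERIV_diff DERIV_along_line[where F = F] smooth_on_differentiable[OF F]) (simp_all add: add_ac)
  from MVT2[OF \<open>h > 0\<close> this] obtain s where s: "0 < s" "s < h"
    "F ((x + h *\<^sub>R v) + h *\<^sub>R u) - F (x + h *\<^sub>R u) - (F (x + h *\<^sub>R v) - F x) =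
      h * (dir_deriv F ((x + h *\<^sub>R v) + s *\<^sub>R u) u - dir_deriv F (x + s *\<^sub>R u) u)"
    by auto
  have "((\<lambda>t. dir_deriv F ((x + s *\<^sub>R u) + t *\<^sub>R v) u) has_real_derivative
      dir_deriv (\<lambda>y. dir_deriv F y u) ((x + s *\<^sub>R u) + t *\<^sub>R v) v) (at t)"
    if "0 \<le> t" "t \<le> h" for t
    using S[of s t] that s
    by (intro DERIV_along_line[where F = "\<lambda>y. dir_deriv F y u"]
        smooth_on_differentiable[OF smooth_on_dir_deriv_const[OF F]]) simp
  from MVT2[OF \<open>h > 0\<close> this] obtain t where t: "0 < t" "t < h"
    "dir_deriv F ((x + s *\<^sub>R u) + h *\<^sub>R v) u - dir_deriv F (x + s *\<^sub>R u) u =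
      h * dir_deriv (\<lambda>y. dir_deriv F y u) ((x + s *\<^sub>R u) + t *\<^sub>R v) v"
    by auto
  have "F (x + h *\<^sub>R u + h *\<^sub>R v) - F (x + h *\<^sub>R u) - F (x + h *\<^sub>R v) + F x =
     h * h * dir_deriv (\<lambda>y. dir_deriv F y u) (x + s *\<^sub>R u + t *\<^sub>R v) v"
    using s(3) t(3) by (simp add: algebra_simps)
  then show ?thesis using s(1,2) t(1,2) by blast
qed

lemma dir_deriv_commute:
  fixes F :: "'a::euclidean_space \<Rightarrow> real"
  assumes "open S" "x \<in> S" and F: "smooth_on S F"
  shows "dir_deriv (\<lambda>y. dir_deriv F y u) x v = dir_deriv (\<lambda>y. dir_deriv F y v) x u"
proof (rule ccontr)
  define A where "A y = dir_deriv (\<lambda>y. dir_deriv F y u) y v" for y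
  define B where "B y = dir_deriv (\<lambda>y. dir_deriv F y v) y u" for y
  assume "\<not> ?thesis"
  \<comment> \<open>The two mixed derivatives will share a value at points near \<open>x\<close>.
    That value cannot be within half the distance of both \<open>A x\<close> and
    \<open>B x\<close>.\<close>
  then have e: "0 < dist (A x) (B x) / 2" by (simp add: A_def B_def)
  have "continuous_on S A" "continuous_on S B"
    unfolding A_def B_def by (intro smooth_on_continuous smooth_on_dir_deriv_const F)+
  then have "continuous (at x) A" "continuous (at x) B"
    using assms(1,2) continuous_on_eq_continuous_at by blast+
  then have "\<exists>a>0. \<forall>y. dist y x < a \<longrightarrow> dist (A y) (A x) < dist (A x) (B x) / 2"
    "\<exists>b>0. \<forall>y. dist y x < b \<longrightarrow> dist (B y) (B x) < dist (A x) (B x) / 2"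
    using e unfolding continuous_at_eps_delta by blast+
  then obtain a b where a: "a > 0" "\<forall>y. dist y x < a \<longrightarrow> dist (A y) (A x) < dist (A x) (B x) / 2"
    and b: "b > 0" "\<forall>y. dist y x < b \<longrightarrow> dist (B y) (B x) < dist (A x) (B x) / 2"
    by auto
  obtain r where r: "r > 0" "ball x r \<subseteq> S"
    using assms(1,2) open_contains_ball by blast
  define d where "d = min r (min a b)"
  \<comment> \<open>Keeps the parallelogram with sides \<open>h *\<^sub>R u\<close> and
    \<open>h *\<^sub>R v\<close> inside the ball of radius \<open>d\<close>; the summand 1 covers u
    = v = 0.\<close>
  define h where "h = d / (2 * (norm u + norm v + 1))"
  have d: "d > 0" using r a b by (simp add: d_def)
  have n: "norm u + norm v + 1 > 0" using norm_ge_zero[of u] norm_ge_zero[of v] by linarith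
  then have h: "h > 0" using d by (simp add: h_def)
  have near: "dist (x + s *\<^sub>R u + t *\<^sub>R v) x < d" "dist (x + t *\<^sub>R v + s *\<^sub>R u) x < d"
    if "0 \<le> s" "s \<le> h" "0 \<le> t" "t \<le> h" for s t
  proof -
    have "norm (s *\<^sub>R u + t *\<^sub>R v) \<le> s * norm u + t * norm v"
      using norm_triangle_ineq[of "s *\<^sub>R u" "t *\<^sub>R v"] that by simp
    also have "\<dots> \<le> h * norm u + h * norm v"
      using that by (intro add_mono mult_right_mono) auto
    also have "\<dots> \<le> h * (norm u + norm v + 1)"
      using h by (simp add: algebra_simps)
    also have "\<dots> = d / 2"
      using n by (simp add: h_def field_simps)
    also have "\<dots> < d" using d by simp
    finally have "norm (s *\<^sub>R u + t *\<^sub>R v) < d" .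
    then show "dist (x + s *\<^sub>R u + t *\<^sub>R v) x < d" "dist (x + t *\<^sub>R v + s *\<^sub>R u) x < d"
      by (simp_all add: dist_norm add_ac)
  qed
  have inS: "x + s *\<^sub>R u + t *\<^sub>R v \<in> S" "x + t *\<^sub>R v + s *\<^sub>R u \<in> S"
    if "0 \<le> s" "s \<le> h" "0 \<le> t" "t \<le> h" for s t
    using near[OF that] r(2) by (auto simp: d_def dist_commute subset_iff)
  obtain s t where st: "0 < s" "s < h" "0 < t" "t < h"
    "F (x + h *\<^sub>R u + h *\<^sub>R v) - F (x + h *\<^sub>R u) - F (x + h *\<^sub>R v) + F x = h * h * A (x + s *\<^sub>R u + t *\<^sub>R v)"
    using second_difference_mean_value[OF F h, of x u v] inS(1)
    unfolding A_def by blast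
  obtain t' s' where ts: "0 < t'" "t' < h" "0 < s'" "s' < h"
    "F (x + h *\<^sub>R v + h *\<^sub>R u) - F (x + h *\<^sub>R v) - F (x + h *\<^sub>R u) + F x = h * h * B (x + t' *\<^sub>R v + s' *\<^sub>R u)"
    using second_difference_mean_value[OF F h, of x v u] inS(2)
    unfolding B_def by blast
  have "h * h * A (x + s *\<^sub>R u + t *\<^sub>R v) = h * h * B (x + t' *\<^sub>R v + s' *\<^sub>R u)"
    using st(5) ts(5)[unfolded add.assoc[of x] add.commute[of "h *\<^sub>R v"]]
    unfolding add.assoc[of x] by linarith
  then have eq: "A (x + s *\<^sub>R u + t *\<^sub>R v) = B (x + t' *\<^sub>R v + s' *\<^sub>R u)"
    using h by simp
  have "dist (A (x + s *\<^sub>R u + t *\<^sub>R v)) (A x) < dist (A x) (B x) / 2"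
    using a(2) near(1)[of s t] st by (simp add: d_def)
  moreover have "dist (B (x + t' *\<^sub>R v + s' *\<^sub>R u)) (B x) < dist (A x) (B x) / 2"
    using b(2) near(2)[of s' t'] ts by (simp add: d_def)
  ultimately show False
    using eq dist_triangle2[of "A x" "B x" "A (x + s *\<^sub>R u + t *\<^sub>R v)"] by (simp add: dist_commute)
qed

section \<open>Koszul formula, metric compatibility and the Lie derivative of the connection\<close>

context metric_on
begin

lemma metric_sym: "x \<in> S \<Longrightarrow> g x u v = g x v u"
  using inner_form.sym[OF inner_form] .

lemma metric_eqI: "x \<in> S \<Longrightarrow> (\<And>z. g x u z = g x v z) \<Longrightarrow> u = v"
  by (rule inner_form.eqI[OF inner_form])

lemmas metric_linear_simps =
  linear_add[OF linear_metric(1)] linear_add[OF linear_metric(2)]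
  linear_diff[OF linear_metric(1)] linear_diff[OF linear_metric(2)]
  linear_scale[OF linear_metric(1)] linear_scale[OF linear_metric(2)]
  linear_neg[OF linear_metric(1)] linear_neg[OF linear_metric(2)]

lemma linear_deriv_metric:
  assumes "x \<in> S"
  shows "linear (\<lambda>v. dir_deriv (\<lambda>y. g y a b) x v)"
    "linear (\<lambda>a. dir_deriv (\<lambda>y. g y a b) x v)"
    "linear (\<lambda>b. dir_deriv (\<lambda>y. g y a b) x v)"
proof -
  show "linear (\<lambda>v. dir_deriv (\<lambda>y. g y a b) x v)"
    by (rule linear_dir_deriv[OF metric_differentiable[OF assms]])
  show "linear (\<lambda>a. dir_deriv (\<lambda>y. g y a b) x v)"
    by (rule linear_dir_deriv_family[where L = "\<lambda>y a. g y a b", OF open_S assms],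
        erule linear_metric, rule metric_differentiable[OF assms])
  show "linear (\<lambda>b. dir_deriv (\<lambda>y. g y a b) x v)"
    by (rule linear_dir_deriv_family[where L = "\<lambda>y b. g y a b", OF open_S assms],
        erule linear_metric, rule metric_differentiable[OF assms])
qed

lemma deriv_metric_sym:
  assumes "x \<in> S"
  shows "dir_deriv (\<lambda>y. g y a b) x v = dir_deriv (\<lambda>y. g y b a) x v"
  by (rule arg_cong[where f = "\<lambda>F. F v"], rule dir_deriv_cong_open[OF open_S assms])
    (rule metric_sym)

text \<open>The Christoffel symbols of the first kind; \<open>christoffel\<close> raises the last
  index.\<close>

definition koszul :: "'a \<Rightarrow> 'a \<Rightarrow> 'a \<Rightarrow> 'a \<Rightarrow> real"
  where "koszul x u v z = (dir_deriv (\<lambda>y. g y v z) x u + dir_deriv (\<lambda>y. g y u z) x v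
      - dir_deriv (\<lambda>y. g y u v) x z) / 2"

lemma linear_koszul:
  assumes "x \<in> S"
  shows "linear (\<lambda>u. koszul x u v z)" "linear (\<lambda>v. koszul x u v z)" "linear (koszul x u v)"
  by (rule linearI; simp add: koszul_def linear_add[OF linear_deriv_metric(1)[OF assms]]
      linear_add[OF linear_deriv_metric(2)[OF assms]] linear_add[OF linear_deriv_metric(3)[OF assms]]
      linear_scale[OF linear_deriv_metric(1)[OF assms]] linear_scale[OF linear_deriv_metric(2)[OF assms]]
      linear_scale[OF linear_deriv_metric(3)[OF assms]] field_simps)+

lemma smooth_koszul: "smooth_on S (\<lambda>x. koszul x u v z)"
  unfolding koszul_def
  by (intro smooth_on_divide smooth_on_diff smooth_on_add smooth_on_const open_S
      smooth_on_dir_deriv_const smooth) auto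

lemma christoffel_eq: "christoffel g x u v = sharp (g x) (koszul x u v)"
  by (simp add: christoffel_def koszul_def[abs_def])

lemma metric_christoffel: "x \<in> S \<Longrightarrow> g x (christoffel g x u v) z = koszul x u v z"
  unfolding christoffel_eq using inner_form.sharp[OF inner_form linear_koszul(3)] .

lemma linear_christoffel:
  assumes "x \<in> S"
  shows "linear (\<lambda>u. christoffel g x u v)" "linear (christoffel g x u)"
  by (rule linearI; rule metric_eqI[OF assms];
    simp add: metric_linear_simps[OF assms] metric_christoffel[OF assms]
      linear_add[OF linear_koszul(1)[OF assms]] linear_add[OF linear_koszul(2)[OF assms]]
      linear_scale[OF linear_koszul(1)[OF assms]] linear_scale[OF linear_koszul(2)[OF assms]])+

lemma smooth_christoffel: "smooth_on S (\<lambda>x. christoffel g x u v)"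
  unfolding christoffel_eq
  by (rule smooth_on_sharp[where l = "\<lambda>x. koszul x u v"], erule linear_koszul, rule smooth_koszul)

text \<open>Metric compatibility \<nabla>g = 0 in coordinates. In the sum of the two Koszul
  expressions everything cancels by symmetry of g except the two halves of the derivative along
  \<open>w\<close>.\<close>

lemma deriv_metric:
  assumes "x \<in> S"
  shows "dir_deriv (\<lambda>y. g y u v) x w = g x (christoffel g x w u) v + g x u (christoffel g x w v)"
  using deriv_metric_sym[OF assms, of u v] deriv_metric_sym[OF assms, of v w]
    deriv_metric_sym[OF assms, of u w]
  by (simp add: metric_sym[OF assms, of u "christoffel g x w v"] metric_christoffel[OF assms] koszul_def
      field_simps)

text \<open>The value of \<open>lie_connection\<close> on vector fields with constant components.\<close>

definition lie_christoffel :: "('a \<Rightarrow> 'a) \<Rightarrow> 'a \<Rightarrow> 'a \<Rightarrow> 'a \<Rightarrow> 'a"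
  where "lie_christoffel V x u v =
    dir_deriv (\<lambda>y. christoffel g y u v) x (V x) - dir_deriv V x (christoffel g x u v)
      + christoffel g x (dir_deriv V x u) v + dir_deriv (\<lambda>y. dir_deriv V y v) x u
      + christoffel g x u (dir_deriv V x v)"

text \<open>Constancy on a neighbourhood kills all derivatives of \<open>X\<close> and
  \<open>Y\<close> that occur. The hypothesis is local because a vector with constant components
  extends to the manifold only near a given point.\<close>

lemma lie_connection_locally_constant:
  assumes "open U" "x \<in> U" "U \<subseteq> S" and V: "smooth_on S V"
    and X: "\<And>y. y \<in> U \<Longrightarrow> X y = u" and Y: "\<And>y. y \<in> U \<Longrightarrow> Y y = v"
  shows "lie_connection g V X Y x = lie_christoffel V x u v"
proof -
  have x: "x \<in> S" using assms by blast
  have dX: "dir_deriv X y = (\<lambda>_. 0)" and dY: "dir_deriv Y y = (\<lambda>_. 0)" if "y \<in> U" for y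
    using dir_deriv_cong_open[OF assms(1) that X] dir_deriv_cong_open[OF assms(1) that Y] by auto
  have "dir_deriv (nabla g X Y) x = dir_deriv (\<lambda>y. christoffel g y u v) x"
    by (rule dir_deriv_cong_open[OF assms(1,2)]) (simp add: nabla_def X Y dY)
  moreover have "nabla g X Y x = christoffel g x u v"
    using assms(2) by (simp add: nabla_def X Y dY)
  moreover have "lie_bracket V X x = - dir_deriv V x u"
    using assms(2) by (simp add: lie_bracket_def X dX)
  moreover have "dir_deriv (lie_bracket V Y) x = dir_deriv (\<lambda>y. - dir_deriv V y v) x"
    by (rule dir_deriv_cong_open[OF assms(1,2)]) (simp add: lie_bracket_def Y dY)
  moreover have "dir_deriv (\<lambda>y. - dir_deriv V y v) x u = - dir_deriv (\<lambda>y. dir_deriv V y v) x u"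
    by (rule dir_deriv_linear[OF bounded_linear_minus[OF bounded_linear_ident]])
      (rule smooth_on_differentiable[OF smooth_on_dir_deriv_const[OF V] x])
  moreover have "lie_bracket V Y x = - dir_deriv V x v"
    using assms(2) by (simp add: lie_bracket_def Y dY)
  ultimately show ?thesis
    using assms(2) unfolding lie_connection_def lie_bracket_def[of V "nabla g X Y"]
    by (simp add: nabla_def[of g "lie_bracket V X" Y] nabla_def[of g X "lie_bracket V Y"]
        lie_christoffel_def X Y dY linear_neg[OF linear_christoffel(1)[OF x]]
        linear_neg[OF linear_christoffel(2)[OF x]])
qed

lemma lie_metric_const:
  assumes "x \<in> S"
  shows "lie_metric g V (\<lambda>_. v) (\<lambda>_. z) x =
    dir_deriv (\<lambda>y. g y v z) x (V x) + g x (dir_deriv V x v) z + g x v (dir_deriv V x z)"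
  by (simp add: lie_metric_def lie_bracket_def metric_linear_simps[OF assms])

text \<open>The right-hand side contains derivatives of the Christoffel terms along
  \<open>V\<close>. On the left they appear after exchanging the derivatives along \<open>u\<close>
  and \<open>V\<close> and replacing the inner derivative of \<open>g\<close> by metric
  compatibility.\<close>

lemma nabla2_lie_metric:
  assumes x: "x \<in> S" and V: "smooth_on S V"
  shows "nabla2 g (\<lambda>_. u) (\<lambda>y v z. lie_metric g V (\<lambda>_. v) (\<lambda>_. z) y) x v z =
    g x (lie_christoffel V x u v) z + g x v (lie_christoffel V x u z)"
proof -
  note dV = smooth_on_differentiable[OF V x] 
  note ddV = smooth_on_differentiable[OF smooth_on_dir_deriv_const[OF V] x]
  note d\<Gamma> = smooth_on_differentiable[OF smooth_christoffel x]
  note dg = metric_differentiable[OF x]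
  note ddg = smooth_on_differentiable[OF smooth_on_dir_deriv_const[OF smooth] x]
  note [simp] = metric_linear_simps[OF x]
  \<comment> \<open>Freezes \<open>V\<close> at \<open>x\<close>, since
    \<open>dir_deriv_commute\<close> deals with constant directions.\<close>
  define W where "W = V x"
  have lin_dg: "linear (dir_deriv (\<lambda>y. g y v z) y)" if "y \<in> S" for y
    by (rule linear_deriv_metric(1)[OF that])
  have "dir_deriv (\<lambda>y. dir_deriv (\<lambda>y. g y v z) y (V y)) x u =
      dir_deriv (\<lambda>y. dir_deriv (\<lambda>y. g y v z) y W) x u + dir_deriv (\<lambda>y. g y v z) x (dir_deriv V x u)"
    unfolding W_def
    by (rule dir_deriv_linear_family[where L = "dir_deriv (\<lambda>y. g y v z)", OF open_S x lin_dg ddg dV])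
  also have "dir_deriv (\<lambda>y. dir_deriv (\<lambda>y. g y v z) y W) x u =
      dir_deriv (\<lambda>y. dir_deriv (\<lambda>y. g y v z) y u) x W"
    by (rule dir_deriv_commute[OF open_S x smooth])
  also have "\<dots> = dir_deriv (\<lambda>y. g y (christoffel g y u v) z + g y v (christoffel g y u z)) x W"
    by (rule arg_cong[where f = "\<lambda>F. F W"], rule dir_deriv_cong_open[OF open_S x])
      (rule deriv_metric)
  also have "\<dots> = dir_deriv (\<lambda>y. g y (christoffel g y u v) z) x W
      + dir_deriv (\<lambda>y. g y v (christoffel g y u z)) x W"
    by (intro dir_deriv_add dir_deriv_metric[OF x] d\<Gamma> differentiable_const)
  also have "dir_deriv (\<lambda>y. g y (christoffel g y u v) z) x W =
      dir_deriv (\<lambda>y. g y (christoffel g x u v) z) x W + g x (dir_deriv (\<lambda>y. christoffel g y u v) x W) z"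
    using dir_deriv_metric(2)[OF x d\<Gamma> differentiable_const[of z], of u v W]
      linear_0[OF linear_metric(2)[OF x]] by simp
  also have "dir_deriv (\<lambda>y. g y v (christoffel g y u z)) x W =
      dir_deriv (\<lambda>y. g y v (christoffel g x u z)) x W + g x v (dir_deriv (\<lambda>y. christoffel g y u z) x W)"
    by (rule dir_deriv_metric_right(2)[OF x d\<Gamma>])
  finally have 1: "dir_deriv (\<lambda>y. dir_deriv (\<lambda>y. g y v z) y (V y)) x u =
      dir_deriv (\<lambda>y. g y (christoffel g x u v) z) x W + g x (dir_deriv (\<lambda>y. christoffel g y u v) x W) z
      + (dir_deriv (\<lambda>y. g y v (christoffel g x u z)) x W + g x v (dir_deriv (\<lambda>y. christoffel g y u z) x W))
      + dir_deriv (\<lambda>y. g y v z) x (dir_deriv V x u)" .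
  have 2: "dir_deriv (\<lambda>y. g y (dir_deriv V y v) z) x u =
      dir_deriv (\<lambda>y. g y (dir_deriv V x v) z) x u + g x (dir_deriv (\<lambda>y. dir_deriv V y v) x u) z"
    using dir_deriv_metric(2)[OF x ddV differentiable_const[of z], of v u]
      linear_0[OF linear_metric(2)[OF x]] by simp
  have 3: "dir_deriv (\<lambda>y. g y v (dir_deriv V y z)) x u =
      dir_deriv (\<lambda>y. g y v (dir_deriv V x z)) x u + g x v (dir_deriv (\<lambda>y. dir_deriv V y z) x u)"
    by (rule dir_deriv_metric_right(2)[OF x ddV])
  have d1: "(\<lambda>y. dir_deriv (\<lambda>y. g y v z) y (V y)) differentiable (at x)"
    by (rule smooth_on_differentiable[OF smooth_on_dir_deriv[OF open_S smooth V] x])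
  have d2: "(\<lambda>y. g y (dir_deriv V y v) z) differentiable (at x)"
    by (rule dir_deriv_metric(1)[OF x ddV differentiable_const])
  have d3: "(\<lambda>y. g y v (dir_deriv V y z)) differentiable (at x)"
    by (rule dir_deriv_metric_right(1)[OF x ddV])
  have "dir_deriv (\<lambda>y. lie_metric g V (\<lambda>_. v) (\<lambda>_. z) y) x u = dir_deriv (\<lambda>y.
      dir_deriv (\<lambda>y. g y v z) y (V y) + g y (dir_deriv V y v) z + g y v (dir_deriv V y z)) x u"
    by (rule arg_cong[where f = "\<lambda>F. F u"], rule dir_deriv_cong_open[OF open_S x])
      (rule lie_metric_const)
  also have "\<dots> = dir_deriv (\<lambda>y. dir_deriv (\<lambda>y. g y v z) y (V y)) x u
      + dir_deriv (\<lambda>y. g y (dir_deriv V y v) z) x u + dir_deriv (\<lambda>y. g y v (dir_deriv V y z)) x u"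
    by (simp add: dir_deriv_add d1 d2 d3)
  finally have 4: "dir_deriv (\<lambda>y. lie_metric g V (\<lambda>_. v) (\<lambda>_. z) y) x u = \<dots>" .
  show ?thesis
    unfolding nabla2_def 4 1 2 3 lie_metric_const[OF x] lie_christoffel_def W_def
    by (simp add: deriv_metric[OF x])
qed

end

section \<open>Curvature, the Weyl tensor and the trace of the Bach tensor\<close>

definition smooth_tensor2 :: "'a::euclidean_space set \<Rightarrow> 'a tensor2 \<Rightarrow> bool"
  where "smooth_tensor2 S T \<longleftrightarrow>
    (\<forall>x\<in>S. \<forall>a. linear (\<lambda>u. T x u a) \<and> linear (T x a)) \<and> (\<forall>u v. smooth_on S (\<lambda>x. T x u v))"

definition smooth_tensor4 :: "'a::euclidean_space set \<Rightarrow> 'a tensor4 \<Rightarrow> bool"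
  where "smooth_tensor4 S T \<longleftrightarrow>
    (\<forall>x\<in>S. \<forall>a b c. linear (\<lambda>u. T x u a b c) \<and> linear (\<lambda>u. T x a u b c) \<and>
      linear (\<lambda>u. T x a b u c) \<and> linear (T x a b c)) \<and>
    (\<forall>u v w z. smooth_on S (\<lambda>x. T x u v w z))"

lemma smooth_tensor2_linear:
  assumes "smooth_tensor2 S T" "x \<in> S"
  shows "linear (\<lambda>u. T x u a)" "linear (T x a)"
  using assms unfolding smooth_tensor2_def by blast+

lemma smooth_tensor2_smooth: "smooth_tensor2 S T \<Longrightarrow> smooth_on S (\<lambda>x. T x u v)"
  unfolding smooth_tensor2_def by blast

lemma smooth_tensor4_linear:
  assumes "smooth_tensor4 S T" "x \<in> S"
  shows "linear (\<lambda>u. T x u a b c)" "linear (\<lambda>u. T x a u b c)"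
    "linear (\<lambda>u. T x a b u c)" "linear (T x a b c)"
  using assms unfolding smooth_tensor4_def by blast+

lemma smooth_tensor4_smooth: "smooth_tensor4 S T \<Longrightarrow> smooth_on S (\<lambda>x. T x u v w z)"
  unfolding smooth_tensor4_def by blast

lemma smooth_tensor4_diff:
  assumes "open S" "smooth_tensor4 S T" "smooth_tensor4 S T'"
  shows "smooth_tensor4 S (\<lambda>x u v w z. T x u v w z - T' x u v w z)"
  using assms unfolding smooth_tensor4_def
  by (auto intro: linear_compose_sub smooth_on_diff)

lemma smooth_tensor4_add:
  assumes "open S" "smooth_tensor4 S T" "smooth_tensor4 S T'"
  shows "smooth_tensor4 S (\<lambda>x u v w z. T x u v w z + T' x u v w z)"
  using assms unfolding smooth_tensor4_def
  by (auto intro: linear_compose_add smooth_on_add)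

lemma linear_mult_left: "linear l \<Longrightarrow> linear (\<lambda>u. c * l u)" for l :: "'a::real_vector \<Rightarrow> real"
  using linear_compose_scale_right[of l c] by simp

lemma linear_mult_right: "linear l \<Longrightarrow> linear (\<lambda>u. l u * c)" for l :: "'a::real_vector \<Rightarrow> real"
  using linear_mult_left[of l c] by (simp add: mult.commute)

lemma smooth_tensor4_mult:
  assumes "open S" "smooth_on S c" "smooth_tensor4 S T"
  shows "smooth_tensor4 S (\<lambda>x u v w z. c x * T x u v w z)"
  using assms unfolding smooth_tensor4_def
  by (auto intro: linear_mult_left smooth_on_mult)

lemma smooth_tensor4_kulkarni_nomizu:
  assumes "open S" "smooth_tensor2 S h" "smooth_tensor2 S k"
  shows "smooth_tensor4 S (kulkarni_nomizu h k)"
proof -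
  have eq: "kulkarni_nomizu h k = (\<lambda>x u v w z. (1 / 2) *
      (h x u z * k x v w + h x v w * k x u z - h x u w * k x v z - h x v z * k x u w))"
    by (simp add: kulkarni_nomizu_def fun_eq_iff)
  note lin = linear_compose_sub linear_compose_add linear_mult_left linear_mult_right
    smooth_tensor2_linear[OF assms(2)] smooth_tensor2_linear[OF assms(3)]
  show ?thesis
    unfolding eq smooth_tensor4_def
    by (intro conjI ballI allI lin smooth_on_mult smooth_on_diff smooth_on_add smooth_on_const
        smooth_tensor2_smooth assms) assumption+
qed

lemma (in inner_form) linear_frame_sum:
  "(\<And>e. linear (\<lambda>v. F v e)) \<Longrightarrow> linear (\<lambda>v. frame_sum b (F v))"
  unfolding frame_sum_def by (rule linear_compose_sum) blast

section \<open>Smoothness of the Riemann, Ricci and Weyl tensors\<close>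

context metric_on
begin

lemma smooth_tensor2_metric: "smooth_tensor2 S g"
  unfolding smooth_tensor2_def using linear_metric smooth by blast

lemma curvature_const:
  assumes "x \<in> S"
  shows "curvature g (\<lambda>_. u) (\<lambda>_. v) (\<lambda>_. w) x =
    dir_deriv (\<lambda>y. christoffel g y v w) x u + christoffel g x u (christoffel g x v w)
    - (dir_deriv (\<lambda>y. christoffel g y u w) x v + christoffel g x v (christoffel g x u w))"
proof -
  have "nabla g (\<lambda>_. a) (\<lambda>_. b) = (\<lambda>y. christoffel g y a b)" for a b
    by (simp add: nabla_def fun_eq_iff)
  moreover have "nabla g (lie_bracket (\<lambda>_. u) (\<lambda>_. v)) (\<lambda>_. w) x = 0"
    by (simp add: nabla_def lie_bracket_def linear_0[OF linear_christoffel(1)[OF assms]])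
  ultimately show ?thesis
    by (simp add: curvature_def nabla_def[of g _ "\<lambda>y. christoffel g y _ _"])
qed

text \<open>Multilinearity and smoothness are read off from the expression of R through \<Gamma> and
  its first derivatives in \<open>curvature_const\<close>.\<close>

lemma smooth_tensor4_riemann: "smooth_tensor4 S (riemann g)"
proof -
  have lin_d: "linear (\<lambda>v. dir_deriv (\<lambda>y. christoffel g y v w) x u)"
    "linear (\<lambda>w. dir_deriv (\<lambda>y. christoffel g y v w) x u)"
    "linear (\<lambda>u. dir_deriv (\<lambda>y. christoffel g y v w) x u)" if "x \<in> S" for x u v w
  proof -
    note d = smooth_on_differentiable[OF smooth_christoffel that]
    show "linear (\<lambda>v. dir_deriv (\<lambda>y. christoffel g y v w) x u)"
      by (rule linear_dir_deriv_family[where L = "\<lambda>y v. christoffel g y v w", OF open_S that],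
          erule linear_christoffel, rule d)
    show "linear (\<lambda>w. dir_deriv (\<lambda>y. christoffel g y v w) x u)"
      by (rule linear_dir_deriv_family[where L = "\<lambda>y w. christoffel g y v w", OF open_S that],
          erule linear_christoffel, rule d)
    show "linear (\<lambda>u. dir_deriv (\<lambda>y. christoffel g y v w) x u)"
      by (rule linear_dir_deriv[OF d])
  qed
  have lin_c: "linear (\<lambda>v. christoffel g x u (christoffel g x v w))"
    "linear (\<lambda>w. christoffel g x u (christoffel g x v w))"
    "linear (\<lambda>u. christoffel g x u (christoffel g x v w))" if "x \<in> S" for x u v w
    using linear_compose[OF linear_christoffel(1)[OF that, of w] linear_christoffel(2)[OF that, of u]]
      linear_compose[OF linear_christoffel(2)[OF that, of v] linear_christoffel(2)[OF that, of u]]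
      linear_christoffel(1)[OF that]
    by (simp_all add: o_def)
  have lin_g: "linear (\<lambda>u. g x (l u) z)" if "x \<in> S" "linear l" for x l z
    using linear_compose[OF that(2) linear_metric(1)[OF that(1)]] by (simp add: o_def)
  have smooth_cc: "smooth_on S (\<lambda>x. christoffel g x u (christoffel g x v w))" for u v w
    by (rule smooth_on_linear_family[where L = "\<lambda>x. christoffel g x u", OF open_S _
          smooth_christoffel smooth_christoffel]) (rule linear_christoffel)
  have lin: "linear (\<lambda>u. riemann g x u a b c) \<and> linear (\<lambda>u. riemann g x a u b c) \<and>
      linear (\<lambda>u. riemann g x a b u c) \<and> linear (riemann g x a b c)" if "x \<in> S" for x a b c
  proof (intro conjI)
    show "linear (riemann g x a b c)"
      using linear_metric(2)[OF that] by (simp add: riemann_def[abs_def])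
  qed (unfold riemann_def curvature_const[OF that],
      (intro lin_g that linear_compose_sub linear_compose_add lin_d lin_c)+)
  moreover have "smooth_on S (\<lambda>x. riemann g x u v w z)" for u v w z
  proof -
    have "smooth_on S (\<lambda>x. g x (dir_deriv (\<lambda>y. christoffel g y v w) x u
      + christoffel g x u (christoffel g x v w) - (dir_deriv (\<lambda>y. christoffel g y u w) x v
      + christoffel g x v (christoffel g x u w))) z)"
      by (intro smooth_on_metric smooth_on_const smooth_on_diff smooth_on_add open_S
          smooth_on_dir_deriv_const smooth_christoffel smooth_cc)
    then show ?thesis
      by (subst smooth_on_cong[OF open_S]) (simp_all add: riemann_def curvature_const)
  qed
  ultimately show ?thesis unfolding smooth_tensor4_def by blast
qed

lemma smooth_tensor2_ricci: "smooth_tensor2 S (ricci g)"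
proof -
  note lin = smooth_tensor4_linear[OF smooth_tensor4_riemann]
  have "linear (\<lambda>u. ricci g x u a)" "linear (ricci g x a)" if "x \<in> S" for x a
    unfolding ricci_def[abs_def] using lin(2,3)[OF that]
    by (intro inner_form.linear_frame_sum[OF inner_form[OF that]]; blast)+
  moreover have "smooth_on S (\<lambda>x. ricci g x u v)" for u v
    unfolding ricci_def
    by (rule smooth_on_frame_sum[where F = "\<lambda>x a b. riemann g x a u v b"])
      (erule lin(4), erule lin(1), rule smooth_tensor4_smooth[OF smooth_tensor4_riemann])
  ultimately show ?thesis unfolding smooth_tensor2_def by blast
qed

lemma smooth_scalar_curvature: "smooth_on S (scalar_curvature g)"
  unfolding scalar_curvature_def[abs_def]
  by (rule smooth_on_frame_sum[where F = "ricci g"])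
    (erule smooth_tensor2_linear[OF smooth_tensor2_ricci], erule smooth_tensor2_linear[OF smooth_tensor2_ricci],
      rule smooth_tensor2_smooth[OF smooth_tensor2_ricci])

lemma smooth_tensor4_weyl: "smooth_tensor4 S (weyl g)"
proof -
  have eq: "weyl g = (\<lambda>x u v w z. (riemann g x u v w z
      - 2 / (real DIM('a) - 2) * kulkarni_nomizu (ricci g) g x u v w z)
      + (1 / ((real DIM('a) - 1) * (real DIM('a) - 2)) * scalar_curvature g x)
          * kulkarni_nomizu g g x u v w z)"
    by (simp add: weyl_def fun_eq_iff)
  show ?thesis
    unfolding eq
    by (intro smooth_tensor4_add smooth_tensor4_diff smooth_tensor4_mult open_S smooth_tensor4_riemann
        smooth_on_const smooth_tensor4_kulkarni_nomizu smooth_tensor2_ricci smooth_tensor2_metric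
        smooth_on_mult smooth_scalar_curvature)
qed

section \<open>Trace-freeness of the Weyl and Bach tensors\<close>

lemma trace_kulkarni_nomizu:
  assumes x: "x \<in> S" and h: "\<And>a. linear (\<lambda>u. h x u a)" "\<And>a. linear (h x a)"
  shows "frame_sum (g x) (\<lambda>e. kulkarni_nomizu h g x e v w e) =
    (frame_sum (g x) (\<lambda>e. h x e e) * g x v w + (real DIM('a) - 2) * h x v w) / 2"
proof -
  interpret inner_form "g x" using inner_form[OF x] .
  have "frame_sum (g x) (\<lambda>e. kulkarni_nomizu h g x e v w e) = frame_sum (g x) (\<lambda>e.
    (1 / 2) * (g x v w * h x e e + h x v w * g x e e - h x e w * g x e v - h x v e * g x e w))"
    by (simp add: kulkarni_nomizu_def sym[of v] mult.commute)
  also have "\<dots> = (1 / 2) * (g x v w * frame_sum (g x) (\<lambda>e. h x e e) + h x v w * real DIM('a)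
      - h x v w - h x v w)"
    by (simp only: frame_sum_mult frame_sum_diff frame_sum_add frame_sum_form
        frame_sum_contract[OF h(1)] frame_sum_contract[OF h(2)])
  finally show ?thesis by (simp add: algebra_simps)
qed

text \<open>The Ricci term contributes S + r g / (n - 2), and the last coefficient times the trace
  (n - 1) g of g \<odot> g gives r g / (n - 2) back. The traced slots are the outer ones, as in
  \<open>ricci\<close>.\<close>

lemma trace_weyl:
  assumes "x \<in> S" "DIM('a) \<ge> 3"
  shows "frame_sum (g x) (\<lambda>e. weyl g x e v w e) = 0"
proof -
  interpret inner_form "g x" using inner_form[OF assms(1)] .
  have n: "real DIM('a) - 2 \<noteq> 0" "real DIM('a) - 1 \<noteq> 0" using assms(2) by auto
  have "frame_sum (g x) (\<lambda>e. weyl g x e v w e) = ricci g x v w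
      - 2 / (real DIM('a) - 2) * ((scalar_curvature g x * g x v w + (real DIM('a) - 2) * ricci g x v w) / 2)
      + scalar_curvature g x / ((real DIM('a) - 1) * (real DIM('a) - 2))
          * ((real DIM('a) * g x v w + (real DIM('a) - 2) * g x v w) / 2)"
    unfolding weyl_def frame_sum_mult frame_sum_diff frame_sum_add
      trace_kulkarni_nomizu[where h = "ricci g", OF assms(1)
        smooth_tensor2_linear[OF smooth_tensor2_ricci assms(1)]]
      trace_kulkarni_nomizu[where h = g, OF assms(1)
        smooth_tensor2_linear[OF smooth_tensor2_metric assms(1)]]
    by (simp add: ricci_def scalar_curvature_def)
  also have "2 / (real DIM('a) - 2) * ((scalar_curvature g x * g x v w + (real DIM('a) - 2) * ricci g x v w) / 2)
      = scalar_curvature g x * g x v w / (real DIM('a) - 2) + ricci g x v w"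
    using n by (simp add: add_divide_distrib)
  also have "(real DIM('a) * g x v w + (real DIM('a) - 2) * g x v w) / 2 = (real DIM('a) - 1) * g x v w"
    by (simp add: field_simps)
  also have "ricci g x v w - (scalar_curvature g x * g x v w / (real DIM('a) - 2) + ricci g x v w)
      + scalar_curvature g x / ((real DIM('a) - 1) * (real DIM('a) - 2)) * ((real DIM('a) - 1) * g x v w) = 0"
    using n by simp
  finally show ?thesis .
qed

text \<open>Contraction commutes with covariant differentiation because \<nabla>g = 0. The chosen
  frame cannot be differentiated, so the derivative is taken of the trace of
  \<open>sharp\<close>.\<close>

lemma trace_nabla2:
  assumes x: "x \<in> S" and T: "smooth_tensor2 S T"
  shows "frame_sum (g x) (\<lambda>e. nabla2 g X T x e e) =
    dir_deriv (\<lambda>y. frame_sum (g y) (\<lambda>e. T y e e)) x (X x)"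
proof -
  interpret inner_form "g x" using inner_form[OF x] .
  note linT = smooth_tensor2_linear[OF T]
  note dT = smooth_on_differentiable[OF smooth_tensor2_smooth[OF T] x]
  define a where "a = X x"
  define N where "N = christoffel g x a"
  define L where "L u = sharp (g x) (T x u)" for u
  \<comment> \<open>By \<open>dir_deriv_sharp\<close>, the derivative of
    \<open>sharp (g y) (T y u)\<close> along \<open>a\<close> is the vector that represents the form
    \<open>T' u\<close>.\<close>
  define T' where "T' u z = dir_deriv (\<lambda>y. T y u z) x a - dir_deriv (\<lambda>y. g y (L u) z) x a" for u z
  have linL: "linear L"
    unfolding L_def by (rule linear_sharp[OF linT(2,1)[OF x]])
  have linN: "linear N" unfolding N_def by (rule linear_christoffel(2)[OF x])
  have linT': "linear (T' u)" "linear (\<lambda>u. T' u z)" for u z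
  proof -
    have "linear (\<lambda>z. dir_deriv (\<lambda>y. T y u z) x a)"
      by (rule linear_dir_deriv_family[where L = "\<lambda>y z. T y u z", OF open_S x linT(2) dT])
    then show "linear (T' u)"
      unfolding T'_def[abs_def] by (rule linear_compose_sub[OF _ linear_deriv_metric(3)[OF x]])
    have "linear (\<lambda>u. dir_deriv (\<lambda>y. T y u z) x a)"
      by (rule linear_dir_deriv_family[where L = "\<lambda>y u. T y u z", OF open_S x linT(1) dT])
    moreover have "linear (\<lambda>u. dir_deriv (\<lambda>y. g y (L u) z) x a)"
      using linear_compose[OF linL linear_deriv_metric(2)[OF x]] by (simp add: o_def)
    ultimately show "linear (\<lambda>u. T' u z)"
      unfolding T'_def by (rule linear_compose_sub)
  qed
  have sharp': "dir_deriv (\<lambda>y. sharp (g y) (T y u)) x a = sharp (g x) (T' u)" for u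
    by (rule sharp_eqI[symmetric], unfold T'_def L_def)
      (rule dir_deriv_sharp[where l = "\<lambda>y. T y u", OF x linT(2) dT])
  have d_sharp: "(\<lambda>y. sharp (g y) (T y u)) differentiable (at x)" for u
    by (rule sharp_differentiable[where l = "\<lambda>y. T y u", OF x linT(2) dT])
  have "dir_deriv (\<lambda>y. frame_sum (g y) (\<lambda>e. T y e e)) x a =
      dir_deriv (\<lambda>y. \<Sum>i\<in>Basis. sharp (g y) (T y i) \<bullet> i) x a"
    by (rule arg_cong[where f = "\<lambda>F. F a"], rule dir_deriv_cong_open[OF open_S x])
      (rule inner_form.frame_sum_eq_trace_sharp[OF inner_form linT(2,1)])
  also have "\<dots> = (\<Sum>i\<in>Basis. dir_deriv (\<lambda>y. sharp (g y) (T y i)) x a \<bullet> i)"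
    using d_sharp
    by (subst dir_deriv_sum) (simp_all add: dir_deriv_linear[OF bounded_linear_inner_left d_sharp])
  also have "\<dots> = frame_sum (g x) (\<lambda>e. T' e e)"
    unfolding sharp' by (rule frame_sum_eq_trace_sharp[symmetric, OF linT'])
  also have "\<dots> = frame_sum (g x) (\<lambda>e. dir_deriv (\<lambda>y. T y e e) x a - g x (N (L e)) e - T x e (N e))"
    unfolding T'_def deriv_metric[OF x] N_def[symmetric] L_def by (simp add: sharp linT[OF x] diff_diff_eq)
  \<comment> \<open>The derivative of the metric has left a term tr(NL); as tr(LN) it is the
    Christoffel correction for the first slot of \<open>T\<close>.\<close>
  also have "\<dots> = frame_sum (g x) (\<lambda>e. dir_deriv (\<lambda>y. T y e e) x a - T x (N e) e - T x e (N e))"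
    unfolding frame_sum_diff L_def frame_sum_commute[OF linT(2,1)[OF x] linN] ..
  finally show ?thesis
    by (simp add: nabla2_def a_def N_def)
qed

text \<open>With the middle arguments frozen, \<open>T\<close> is a (0,2) tensor to which
  \<open>trace_nabla2\<close> applies. The corrections for the middle slots are themselves traces of
  \<open>T\<close> and vanish.\<close>

lemma trace_nabla4:
  assumes x: "x \<in> S"
    and lin: "\<And>x v w z. x \<in> S \<Longrightarrow> linear (\<lambda>u. T x u v w z)"
      "\<And>x u v w. x \<in> S \<Longrightarrow> linear (T x u v w)"
    and smooth_T: "\<And>u v w z. smooth_on S (\<lambda>x. T x u v w z)"
    and tr: "\<And>x v w. x \<in> S \<Longrightarrow> frame_sum (g x) (\<lambda>e. T x e v w e) = 0"
  shows "frame_sum (g x) (\<lambda>e. nabla4 g X T x e v w e) = 0"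
proof -
  interpret inner_form "g x" using inner_form[OF x] .
  have "smooth_tensor2 S (\<lambda>x u z. T x u v w z)"
    unfolding smooth_tensor2_def using lin smooth_T by blast
  from trace_nabla2[OF x this, of X]
  have "frame_sum (g x) (\<lambda>e. nabla2 g X (\<lambda>x u z. T x u v w z) x e e) =
      dir_deriv (\<lambda>y. frame_sum (g y) (\<lambda>e. T y e v w e)) x (X x)" .
  also have "\<dots> = dir_deriv (\<lambda>_. 0 :: real) x (X x)"
    by (rule arg_cong[where f = "\<lambda>F. F (X x)"], rule dir_deriv_cong_open[OF open_S x]) (rule tr)
  finally have 0: "frame_sum (g x) (\<lambda>e. nabla2 g X (\<lambda>x u z. T x u v w z) x e e) = 0"
    by simp
  have "nabla4 g X T x e v w e = nabla2 g X (\<lambda>x u z. T x u v w z) x e e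
      - T x e (christoffel g x (X x) v) w e - T x e v (christoffel g x (X x) w) e" for e
    by (simp add: nabla4_def nabla2_def)
  then show ?thesis
    by (simp only: frame_sum_diff tr[OF x] 0)
qed

text \<open>Makes \<open>trace_nabla4\<close> applicable a second time, to the covariant derivative
  of W along a constant field.\<close>

lemma nabla4_smooth:
  assumes T: "smooth_tensor4 S T"
  shows "x \<in> S \<Longrightarrow> linear (\<lambda>u. nabla4 g (\<lambda>_. b) T x u v w z)"
    "x \<in> S \<Longrightarrow> linear (nabla4 g (\<lambda>_. b) T x u v w)"
    "smooth_on S (\<lambda>x. nabla4 g (\<lambda>_. b) T x u v w z)"
proof -
  note linT = smooth_tensor4_linear[OF T]
  note smT = smooth_tensor4_smooth[OF T]
  show "linear (\<lambda>u. nabla4 g (\<lambda>_. b) T x u v w z)" if x: "x \<in> S"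
  proof -
    have "linear (\<lambda>u. dir_deriv (\<lambda>y. T y u v w z) x b)"
      by (rule linear_dir_deriv_family[where L = "\<lambda>y u. T y u v w z",
            OF open_S x linT(1) smooth_on_differentiable[OF smT x]])
    moreover have "linear (\<lambda>u. T x (christoffel g x b u) v w z)"
      using linear_compose[OF linear_christoffel(2)[OF x] linT(1)[OF x]] by (simp add: o_def)
    ultimately show ?thesis
      unfolding nabla4_def by (intro linear_compose_sub linT(1)[OF x])
  qed
  show "linear (nabla4 g (\<lambda>_. b) T x u v w)" if x: "x \<in> S"
  proof -
    have "linear (\<lambda>z. dir_deriv (\<lambda>y. T y u v w z) x b)"
      by (rule linear_dir_deriv_family[where L = "\<lambda>y z. T y u v w z",
            OF open_S x linT(4) smooth_on_differentiable[OF smT x]])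
    moreover have "linear (\<lambda>z. T x u v w (christoffel g x b z))"
      using linear_compose[OF linear_christoffel(2)[OF x] linT(4)[OF x]] by (simp add: o_def)
    ultimately show ?thesis
      unfolding nabla4_def[abs_def] by (intro linear_compose_sub linT(4)[OF x])
  qed
  have "smooth_on S (\<lambda>x. T x (christoffel g x b u) v w z)"
    by (rule smooth_on_linear_family[where L = "\<lambda>x u. T x u v w z", OF open_S linT(1) smT smooth_christoffel])
  moreover have "smooth_on S (\<lambda>x. T x u (christoffel g x b v) w z)"
    by (rule smooth_on_linear_family[where L = "\<lambda>x v. T x u v w z", OF open_S linT(2) smT smooth_christoffel])
  moreover have "smooth_on S (\<lambda>x. T x u v (christoffel g x b w) z)"
    by (rule smooth_on_linear_family[where L = "\<lambda>x w. T x u v w z", OF open_S linT(3) smT smooth_christoffel])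
  moreover have "smooth_on S (\<lambda>x. T x u v w (christoffel g x b z))"
    by (rule smooth_on_linear_family[where L = "\<lambda>x z. T x u v w z", OF open_S linT(4) smT smooth_christoffel])
  ultimately show "smooth_on S (\<lambda>x. nabla4 g (\<lambda>_. b) T x u v w z)"
    unfolding nabla4_def by (intro smooth_on_diff open_S smooth_on_dir_deriv_const smT)
qed

text \<open>Two instances of \<open>trace_nabla4\<close>: an iterated derivative of W along constant
  fields, and a first derivative along the non-constant field
  \<open>nabla g (\<lambda>_. a) (\<lambda>_. b)\<close>.\<close>

lemma trace_second_nabla4_weyl:
  assumes x: "x \<in> S" and n: "DIM('a) \<ge> 3"
  shows "frame_sum (g x) (\<lambda>e. second_nabla4 g a b (weyl g) x e v w e) = 0"
proof -
  interpret inner_form "g x" using inner_form[OF x] .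
  note W = smooth_tensor4_weyl
  have tr: "frame_sum (g y) (\<lambda>e. nabla4 g Y (weyl g) y e v w e) = 0" if "y \<in> S" for y Y v w
    by (rule trace_nabla4[OF that smooth_tensor4_linear(1,4)[OF W] smooth_tensor4_smooth[OF W]
          trace_weyl[OF _ n]])
  have "frame_sum (g x) (\<lambda>e. nabla4 g (\<lambda>_. a) (nabla4 g (\<lambda>_. b) (weyl g)) x e v w e) = 0"
    by (rule trace_nabla4[OF x nabla4_smooth[OF W] tr])
  then show ?thesis
    unfolding second_nabla4_def frame_sum_diff tr[OF x] by simp
qed

text \<open>The free slots of \<open>bach\<close> are the outer slots of W. Once the sum over them
  is moved innermost, both terms vanish for each fixed \<open>a\<close> and
  \<open>b\<close>.\<close>

lemma trace_bach:
  assumes x: "x \<in> S" and n: "DIM('a) \<ge> 3"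
  shows "frame_sum (g x) (\<lambda>e. bach g x e e) = 0"
proof -
  interpret inner_form "g x" using inner_form[OF x] .
  have swap: "frame_sum (g x) (\<lambda>e. frame_sum (g x) (\<lambda>a. frame_sum (g x) (\<lambda>b. K e a b))) =
      frame_sum (g x) (\<lambda>a. frame_sum (g x) (\<lambda>b. frame_sum (g x) (\<lambda>e. K e a b)))" for K
    using frame_sum_swap[of "\<lambda>e a. frame_sum (g x) (K e a)"] frame_sum_swap[of "\<lambda>e. K e _"]
    by simp
  show ?thesis
    unfolding bach_def frame_sum_add frame_sum_mult swap trace_second_nabla4_weyl[OF x n]
      trace_weyl[OF x n]
    by (simp add: frame_sum_0)
qed

lemma trace_omega_bach:
  assumes x: "x \<in> S" and n: "DIM('a) \<ge> 3"
  shows "frame_sum (g x) (\<lambda>e. omega_bach g P \<beta> x e e) = - \<beta> * g x (P x) (P x)"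
proof -
  interpret inner_form "g x" using inner_form[OF x] .
  show ?thesis
    unfolding omega_bach_def one_form_def frame_sum_diff frame_sum_mult trace_bach[OF x n]
      frame_sum_contract[OF linear_left]
    by simp
qed

section \<open>The soliton equation in a chart\<close>

text \<open>Solving the soliton equation for B_\<omega> leaves only \<open>l\<close>,
  \<open>g\<close> and the Lie derivative of \<open>g\<close>. This gives the smoothness of
  B_\<omega> directly and reduces its covariant derivative to
  \<open>nabla2_lie_metric\<close>.\<close>

lemma nabla2_omega_bach:
  assumes V: "smooth_on S V" and l: "smooth_on S l" and f: "smooth_on S f"
    and soliton: "\<And>x u v. x \<in> S \<Longrightarrow>
      1 / 2 * lie_metric g V (\<lambda>_. u) (\<lambda>_. v) x + omega_bach g P \<beta> x u v = l x * g x u v"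
    and affine: "\<And>x u v. x \<in> S \<Longrightarrow> lie_christoffel V x u v =
      dir_deriv f x u *\<^sub>R v + dir_deriv f x v *\<^sub>R u - g x u v *\<^sub>R gradient g f x"
    and x: "x \<in> S"
  shows "nabla2 g X (omega_bach g P \<beta>) x v z = dir_deriv (\<lambda>y. l y - f y) x (X x) * g x v z"
    "smooth_tensor2 S (omega_bach g P \<beta>)"
proof -
  define h where "h y v z = lie_metric g V (\<lambda>_. v) (\<lambda>_. z) y" for y v z
  have B: "omega_bach g P \<beta> y u v = l y * g y u v - 1 / 2 * h y u v" if "y \<in> S" for y u v
    using soliton[OF that, of u v] by (simp add: h_def)
  have h: "h y u v = dir_deriv (\<lambda>y. g y u v) y (V y) + g y (dir_deriv V y u) v + g y u (dir_deriv V y v)"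
    if "y \<in> S" for y u v
    unfolding h_def by (rule lie_metric_const[OF that])
  have sm_h: "smooth_on S (\<lambda>y. h y u v)" for u v
  proof -
    have "smooth_on S (\<lambda>y. dir_deriv (\<lambda>y. g y u v) y (V y) + g y (dir_deriv V y u) v
        + g y u (dir_deriv V y v))"
      by (intro smooth_on_add smooth_on_metric smooth_on_dir_deriv smooth_on_dir_deriv_const
          smooth_on_const smooth V open_S)
    then show ?thesis by (subst smooth_on_cong[OF open_S h])
  qed
  have lin_h: "linear (\<lambda>u. h y u a)" "linear (h y a)" if "y \<in> S" for y a
  proof -
    have dV: "linear (dir_deriv V y)"
      by (rule linear_dir_deriv[OF smooth_on_differentiable[OF V that]])
    have "linear (\<lambda>u. g y (dir_deriv V y u) a)" "linear (\<lambda>u. g y a (dir_deriv V y u))"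
      using linear_compose[OF dV linear_metric(1)[OF that]] linear_compose[OF dV linear_metric(2)[OF that]]
      by (simp_all add: o_def)
    then show "linear (\<lambda>u. h y u a)" "linear (h y a)"
      unfolding h[OF that, abs_def] h[OF that]
      using linear_deriv_metric[OF that] linear_metric[OF that]
      by (auto intro!: linear_compose_add)
  qed
  show "smooth_tensor2 S (omega_bach g P \<beta>)"
    unfolding smooth_tensor2_def
  proof (intro conjI ballI allI)
    show "linear (\<lambda>u. omega_bach g P \<beta> y u a)" "linear (omega_bach g P \<beta> y a)" if "y \<in> S" for y a
      unfolding B[OF that, abs_def]
      by (intro linear_compose_sub linear_mult_left lin_h linear_metric that)+
    have "smooth_on S (\<lambda>y. l y * g y u v - 1 / 2 * h y u v)" for u v
      by (intro smooth_on_diff smooth_on_mult smooth_on_const l smooth sm_h open_S)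
    then show "smooth_on S (\<lambda>y. omega_bach g P \<beta> y u v)" for u v
      by (subst smooth_on_cong[OF open_S B])
  qed
  note dl = smooth_on_differentiable[OF l x] and df = smooth_on_differentiable[OF f x]
  note dg = metric_differentiable[OF x] and dh = smooth_on_differentiable[OF sm_h x]
  define u where "u = X x"
  have grad: "g x (gradient g f x) z = dir_deriv f x z" for z
    unfolding gradient_def by (rule inner_form.sharp[OF inner_form[OF x] linear_dir_deriv[OF df]])
  have nabla_h: "nabla2 g X h x v z = 2 * dir_deriv f x u * g x v z"
  proof -
    have "nabla2 g X h x v z = nabla2 g (\<lambda>_. u) h x v z"
      by (simp add: nabla2_def u_def)
    also have "\<dots> = g x (lie_christoffel V x u v) z + g x v (lie_christoffel V x u z)"
      unfolding h_def[abs_def] by (rule nabla2_lie_metric[OF x V])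
    \<comment> \<open>The two terms with the derivative of \<open>f\<close> along \<open>u\<close>
      add up. The gradient term of each summand cancels the remaining term of the other.\<close>
    also have "\<dots> = 2 * dir_deriv f x u * g x v z"
      by (simp add: affine[OF x] metric_linear_simps[OF x] grad metric_sym[OF x, of v "gradient g f x"]
          metric_sym[OF x, of v u])
    finally show ?thesis .
  qed
  have "dir_deriv (\<lambda>y. omega_bach g P \<beta> y v z) x u = dir_deriv (\<lambda>y. l y * g y v z - 1 / 2 * h y v z) x u"
    by (rule arg_cong[where f = "\<lambda>F. F u"], rule dir_deriv_cong_open[OF open_S x]) (rule B)
  also have "\<dots> = l x * dir_deriv (\<lambda>y. g y v z) x u + dir_deriv l x u * g x v z
      - 1 / 2 * dir_deriv (\<lambda>y. h y v z) x u"
    using dir_deriv_diff[of "\<lambda>y. l y * g y v z" x "\<lambda>y. 1 / 2 * h y v z"] dl dg dh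
      dir_deriv_mult[OF dl dg] dir_deriv_mult[OF differentiable_const dh, of "1 / 2"]
    by simp
  finally have "nabla2 g X (omega_bach g P \<beta>) x v z = l x * nabla2 g X g x v z
      + dir_deriv l x u * g x v z - 1 / 2 * nabla2 g X h x v z"
    by (simp add: nabla2_def u_def B[OF x] algebra_simps)
  moreover have "nabla2 g X g x v z = 0"
    by (simp add: nabla2_def deriv_metric[OF x])
  ultimately show "nabla2 g X (omega_bach g P \<beta>) x v z = dir_deriv (\<lambda>y. l y - f y) x (X x) * g x v z"
    using nabla_h by (simp add: dir_deriv_diff[OF dl df] u_def algebra_simps)
qed

lemma soliton_local:
  assumes "smooth_on S V" "smooth_on S l" "smooth_on S f"
    and "\<And>x u v. x \<in> S \<Longrightarrow>
      1 / 2 * lie_metric g V (\<lambda>_. u) (\<lambda>_. v) x + omega_bach g P \<beta> x u v = l x * g x u v"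
    and "\<And>x u v. x \<in> S \<Longrightarrow> lie_christoffel V x u v =
      dir_deriv f x u *\<^sub>R v + dir_deriv f x v *\<^sub>R u - g x u v *\<^sub>R gradient g f x"
    and x: "x \<in> S" and n: "DIM('a) \<ge> 3"
  shows "divergence g (omega_bach g P \<beta>) x z = dir_deriv (\<lambda>y. l y - f y) x z"
    and "dir_deriv (\<lambda>y. - \<beta> * g y (P y) (P y)) x z = real DIM('a) * dir_deriv (\<lambda>y. l y - f y) x z"
proof -
  interpret inner_form "g x" using inner_form[OF x] .
  note * = nabla2_omega_bach[OF assms(1-5) x]
  have d: "linear (dir_deriv (\<lambda>y. l y - f y) x)"
    by (rule linear_dir_deriv)
      (rule smooth_on_differentiable[OF smooth_on_diff[OF open_S assms(2,3)] x])
  have nabla: "nabla2 g (\<lambda>_. e) (omega_bach g P \<beta>) x v w = dir_deriv (\<lambda>y. l y - f y) x e * g x v w"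
    for e v w
    by (rule *(1))
  show "divergence g (omega_bach g P \<beta>) x z = dir_deriv (\<lambda>y. l y - f y) x z"
    unfolding divergence_def nabla by (rule frame_sum_contract[OF d])
  have "dir_deriv (\<lambda>y. - \<beta> * g y (P y) (P y)) x z =
      dir_deriv (\<lambda>y. frame_sum (g y) (\<lambda>e. omega_bach g P \<beta> y e e)) x z"
    by (rule arg_cong[where f = "\<lambda>F. F z"], rule dir_deriv_cong_open[OF open_S x])
      (rule trace_omega_bach[symmetric, OF _ n])
  also have "\<dots> = frame_sum (g x) (\<lambda>e. nabla2 g (\<lambda>_. z) (omega_bach g P \<beta>) x e e)"
    by (rule trace_nabla2[OF x *(2), symmetric])
  also have "\<dots> = real DIM('a) * dir_deriv (\<lambda>y. l y - f y) x z"
    unfolding nabla frame_sum_mult by simp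
  finally show "dir_deriv (\<lambda>y. - \<beta> * g y (P y) (P y)) x z = real DIM('a) * dir_deriv (\<lambda>y. l y - f y) x z" .
qed

end

section \<open>Bump functions and extension of tangent vectors\<close>

text \<open>The function t^(-n) exp(-1/t), extended by zero. The whole family in \<open>n\<close> is
  introduced because its linear span is closed under differentiation.\<close>

definition flat :: "nat \<Rightarrow> real \<Rightarrow> real"
  where "flat n t = (if t > 0 then inverse t ^ n / exp (inverse t) else 0)"

text \<open>Under the substitution s = 1/t this is the decay of s^n / exp s at infinity.\<close>

lemma flat_tendsto_0: "(flat n \<longlongrightarrow> 0) (at 0)"
proof -
  have "((\<lambda>t. inverse t ^ n / exp (inverse t)) \<longlongrightarrow> 0) (at_right (0::real))"
    by (rule filterlim_compose[OF tendsto_power_div_exp_0 filterlim_inverse_at_top_right])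
  then have "(flat n \<longlongrightarrow> 0) (at_right 0)"
    by (rule Lim_transform_eventually) (auto simp: flat_def eventually_at_filter)
  moreover have "(flat n \<longlongrightarrow> 0) (at_left 0)"
    by (rule Lim_transform_eventually[OF tendsto_const]) (auto simp: flat_def eventually_at_filter)
  ultimately show ?thesis using filterlim_split_at by blast
qed

lemma DERIV_flat:
  "(flat n has_real_derivative (flat (n + 2) t - real n * flat (n + 1) t)) (at t)"
proof (cases t "0 :: real" rule: linorder_cases)
  case less
  have "((\<lambda>_. 0) has_real_derivative 0) (at t)" by simp
  then have "(flat n has_real_derivative 0) (at t)"
    by (rule has_field_derivative_transform_within_open[where S = "{..<0}"])
      (use less in \<open>auto simp: flat_def\<close>)
  then show ?thesis using less by (simp add: flat_def)
next
  case equal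
  \<comment> \<open>The difference quotient of \<open>flat n\<close> at 0 is
    \<open>flat (n + 1)\<close>.\<close>
  have "(flat (n + 1) \<longlongrightarrow> 0) (at 0)" by (rule flat_tendsto_0)
  then have "((\<lambda>h. (flat n (0 + h) - flat n 0) / h) \<longlongrightarrow> 0) (at 0)"
    by (rule Lim_transform_eventually)
      (auto simp: flat_def eventually_at_filter field_simps)
  then show ?thesis using equal by (simp add: DERIV_def flat_def)
next
  case greater
  have inv: "((\<lambda>t. inverse t) has_real_derivative - (inverse t * inverse t)) (at t)"
    using DERIV_inverse[of t] greater by (simp add: power2_eq_square)
  have pow: "((\<lambda>t. inverse t ^ n) has_real_derivative - (real n * inverse t ^ (n + 1))) (at t)"
  proof (induction n)
    case (Suc n)
    from DERIV_mult[OF inv this] show ?case by (simp add: algebra_simps)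
  qed simp
  have "((\<lambda>t. inverse t ^ n / exp (inverse t)) has_real_derivative
      (flat (n + 2) t - real n * flat (n + 1) t)) (at t)"
  proof (rule DERIV_cong[OF DERIV_divide[OF pow DERIV_chain2[OF DERIV_exp inv]]])
    show "(- (real n * inverse t ^ (n + 1)) * exp (inverse t)
        - inverse t ^ n * (exp (inverse t) * - (inverse t * inverse t)))
        / (exp (inverse t) * exp (inverse t)) = flat (n + 2) t - real n * flat (n + 1) t"
      using greater unfolding flat_def by (simp add: divide_simps) (simp add: algebra_simps)
  qed simp
  then show ?thesis
    by (rule has_field_derivative_transform_within_open[where S = "{0<..}"])
      (use greater in \<open>auto simp: flat_def\<close>)
qed

lemma smooth_on_flat: "smooth_on UNIV (flat n)"
proof -
  have "times_differentiable_on k UNIV (flat n)" for k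
  proof (induction k arbitrary: n)
    case 0
    show ?case
      using DERIV_isCont[OF DERIV_flat] by (simp add: continuous_at_imp_continuous_on)
  next
    case (Suc k)
    have d: "dir_deriv (flat n) = (\<lambda>t v. (flat (n + 2) t - real n * flat (n + 1) t) * v)"
      by (rule ext, rule dir_deriv_eqI) (rule DERIV_flat[unfolded has_field_derivative_def])
    have "times_differentiable_on k UNIV (\<lambda>t. (flat (n + 2) t - real n * flat (n + 1) t) * v)" for v
      by (intro times_differentiable_on_mult times_differentiable_on_diff
          times_differentiable_on_const Suc.IH open_UNIV)
    moreover have "flat n differentiable (at t)" for t
      using DERIV_flat[of n t] real_differentiable_def differentiableI has_field_derivative_def by blast
    ultimately show ?case
      unfolding times_differentiable_on_Suc d by blast
  qed
  then show ?thesis by (simp add: smooth_on_def)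
qed

lemma ex_bump_function:
  fixes x :: "'a::euclidean_space"
  assumes "r > 0"
  shows "\<exists>\<eta>. smooth_on UNIV \<eta> \<and> (\<forall>y\<in>ball x (r / 2). \<eta> y = (1::real)) \<and> (\<forall>y. y \<notin> ball x r \<longrightarrow> \<eta> y = 0)"
proof -
  \<comment> \<open>\<open>a\<close> vanishes exactly outside the open ball of radius
    \<open>r\<close>, and \<open>b\<close> exactly on the closed ball of radius r/2. They never
    vanish together, so a / (a + b) is smooth.\<close>
  define a b where "a y = flat 0 (r\<^sup>2 - (y - x) \<bullet> (y - x))"
    and "b y = flat 0 ((y - x) \<bullet> (y - x) - (r / 2)\<^sup>2)" for y
  have sq: "smooth_on UNIV (\<lambda>y. (y - x) \<bullet> (y - x))"
    by (intro smooth_on_bilinear[OF open_UNIV bounded_bilinear_inner] smooth_on_diff smooth_on_ident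
        smooth_on_const open_UNIV)
  have "smooth_on UNIV a" "smooth_on UNIV b"
    unfolding a_def b_def
    by (rule smooth_on_compose[where H = "flat 0", OF open_UNIV open_UNIV subset_UNIV smooth_on_flat],
        intro smooth_on_diff smooth_on_const sq open_UNIV)+
  moreover have pos: "a y + b y > 0" for y
  proof -
    have "(r / 2)\<^sup>2 < r\<^sup>2" using assms by (simp add: power2_eq_square)
    then show ?thesis by (auto simp: a_def b_def flat_def add_pos_pos)
  qed
  moreover have "a y + b y \<noteq> 0" for y using pos[of y] by simp
  ultimately have "smooth_on UNIV (\<lambda>y. a y / (a y + b y))"
    by (intro smooth_on_divide smooth_on_add open_UNIV) assumption+
  moreover have "a y / (a y + b y) = 1" if "y \<in> ball x (r / 2)" for y
  proof -
    have "(norm (y - x))\<^sup>2 < (r / 2)\<^sup>2"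
      using that by (intro power_strict_mono) (auto simp: dist_norm norm_minus_commute)
    then have "b y = 0" by (simp add: b_def flat_def dot_square_norm)
    then show ?thesis using pos[of y] by simp
  qed
  moreover have "a y / (a y + b y) = 0" if "y \<notin> ball x r" for y
  proof -
    have "r\<^sup>2 \<le> (norm (y - x))\<^sup>2"
      using that assms by (intro power_mono) (auto simp: dist_norm norm_minus_commute)
    then have "a y = 0" by (simp add: a_def flat_def dot_square_norm)
    then show ?thesis by simp
  qed
  ultimately show ?thesis by blast
qed

section \<open>Charts and transition maps\<close>

lemma
  assumes "is_chart c"
  shows chart_open: "open (fst c)" "open (chart_image c)"
    and chart_continuous: "continuous_on (fst c) (snd c)" "continuous_on (chart_image c) (coord_inv c)"
    and coord_inv_snd [simp]: "p \<in> fst c \<Longrightarrow> coord_inv c (snd c p) = p"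
    and snd_coord_inv [simp]: "y \<in> chart_image c \<Longrightarrow> snd c (coord_inv c y) = y"
    and coord_inv_in: "y \<in> chart_image c \<Longrightarrow> coord_inv c y \<in> fst c"
  using assms unfolding is_chart_def homeomorphism_def by auto

lemma snd_in_chart_image: "p \<in> fst c \<Longrightarrow> snd c p \<in> chart_image c"
  by (simp add: chart_image_def)

lemma chart_image_open:
  assumes "is_chart c" "open W"
  shows "open (snd c ` (fst c \<inter> W))" "open {y \<in> chart_image c. coord_inv c y \<in> W}"
proof -
  have "open (chart_image c \<inter> coord_inv c -` W)"
    by (rule continuous_open_preimage[OF chart_continuous(2) chart_open(2)]) (fact assms)+
  moreover have "chart_image c \<inter> coord_inv c -` W = snd c ` (fst c \<inter> W)"
    using assms(1) by (force simp: chart_image_def)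
  moreover have "{y \<in> chart_image c. coord_inv c y \<in> W} = chart_image c \<inter> coord_inv c -` W"
    by auto
  ultimately show "open (snd c ` (fst c \<inter> W))" "open {y \<in> chart_image c. coord_inv c y \<in> W}"
    by simp_all
qed

lemma
  assumes "smooth_atlas A"
  shows atlas_chart: "c \<in> A \<Longrightarrow> is_chart c"
    and atlas_cover: "\<exists>c\<in>A. p \<in> fst c"
    and smooth_transition: "c \<in> A \<Longrightarrow> d \<in> A \<Longrightarrow> smooth_on (snd c ` (fst c \<inter> fst d)) (transition c d)"
  using assms unfolding smooth_atlas_def by blast+

lemma transition_differentiable:
  assumes "smooth_atlas A" "c \<in> A" "d \<in> A" "p \<in> fst c" "p \<in> fst d"
  shows "transition c d differentiable (at (snd c p))"
  using smooth_on_differentiable[OF smooth_transition[OF assms(1-3)]] assms(4,5) by blast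

lemma transition_snd:
  assumes "is_chart c" "p \<in> fst c"
  shows "transition c d (snd c p) = snd d p"
  using assms by (simp add: transition_def)

text \<open>The cocycle identity for differentials. It makes a field that is transported out of one
  chart obey the transformation law between any two charts.\<close>

lemma dir_deriv_transition_chain:
  assumes A: "smooth_atlas A" "c \<in> A" "d \<in> A" "e \<in> A"
    and p: "p \<in> fst c" "p \<in> fst d" "p \<in> fst e"
  shows "dir_deriv (transition c e) (snd c p) u =
    dir_deriv (transition d e) (snd d p) (dir_deriv (transition c d) (snd c p) u)"
proof -
  note chart = atlas_chart[OF A(1)]
  have "dir_deriv (transition c e) (snd c p) = dir_deriv (\<lambda>y. transition d e (transition c d y)) (snd c p)"
  proof (rule dir_deriv_cong_open)
    show "open (snd c ` (fst c \<inter> fst d))"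
      by (intro chart_image_open(1) chart chart_open A)
    show "snd c p \<in> snd c ` (fst c \<inter> fst d)" using p by blast
    show "transition c e y = transition d e (transition c d y)" if "y \<in> snd c ` (fst c \<inter> fst d)" for y
      using that by (auto simp: transition_def coord_inv_snd[OF chart[OF A(2)]] coord_inv_snd[OF chart[OF A(3)]])
  qed
  then show ?thesis
    using transition_differentiable[OF A(1,3,4) p(2,3)] transition_differentiable[OF A(1-3) p(1,2)]
      transition_snd[OF chart[OF A(2)] p(1), of d]
    by (simp add: dir_deriv_chain)
qed

text \<open>
  Cut off the constant field \<open>u\<close> by a bump function in the chart and extend it by zero; the result
  is smooth because the support is compact and hence closed in the Hausdorff space \<open>M\<close>.
\<close>

lemma ex_vector_field_locally_constant:
  fixes A :: "('m::{t2_space, second_countable_topology}, 'a::euclidean_space) chart set"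
  assumes A: "smooth_atlas A" and c: "c \<in> A" and x: "x \<in> chart_image c"
  shows "\<exists>X U. vector_field A X \<and> open U \<and> x \<in> U \<and> U \<subseteq> chart_image c \<and> (\<forall>y\<in>U. X c y = u)"
proof -
  note chart = atlas_chart[OF A]
  have open_c: "open (fst c)" by (rule chart_open(1)[OF chart[OF c]])
  obtain r where r: "r > 0" "cball x r \<subseteq> chart_image c"
    using chart_open(2)[OF chart[OF c]] x open_contains_cball by blast
  obtain \<eta> :: "'a \<Rightarrow> real" where \<eta>: "smooth_on UNIV \<eta>" "\<forall>y\<in>ball x (r / 2). \<eta> y = 1"
    "\<forall>y. y \<notin> ball x r \<longrightarrow> \<eta> y = 0"
    using ex_bump_function[OF r(1), of x] by blast
  define K where "K = coord_inv c ` cball x r"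
  have "compact K"
    unfolding K_def using chart_continuous(2)[OF chart[OF c]] r(2)
    by (intro compact_continuous_image) (auto intro: continuous_on_subset)
  then have K: "open (- K)" using compact_imp_closed by blast
  have \<eta>0: "\<eta> (snd c p) = 0" if "p \<in> fst c" "p \<notin> K" for p
  proof -
    have "snd c p \<notin> cball x r"
      using that coord_inv_snd[OF chart[OF c] that(1)] unfolding K_def by (metis imageI)
    then show ?thesis using \<eta>(3) by auto
  qed
  define X where "X d y = (let p = coord_inv d y in if p \<in> fst c
    then \<eta> (snd c p) *\<^sub>R dir_deriv (transition c d) (snd c p) u else 0)"
    for d :: "('m, 'a) chart" and y
  have Xp: "X d (snd d p) = (if p \<in> fst c
    then \<eta> (snd c p) *\<^sub>R dir_deriv (transition c d) (snd c p) u else 0)" if "d \<in> A" "p \<in> fst d" for d p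
    using that by (simp add: X_def coord_inv_snd[OF chart])
  have "smooth_on (chart_image d) (X d)" if d: "d \<in> A" for d
  proof (rule smooth_on_local)
    fix y assume y: "y \<in> chart_image d"
    define q where "q = coord_inv d y"
    have q: "q \<in> fst d" "snd d q = y"
      unfolding q_def using coord_inv_in[OF chart[OF d] y] snd_coord_inv[OF chart[OF d] y] by auto
    show "\<exists>U. open U \<and> y \<in> U \<and> smooth_on U (X d)"
    \<comment> \<open>The domain of \<open>c\<close> and the complement of \<open>K\<close> are open
      and cover the manifold: on the first the defining formula is smooth, on the second the field
      is zero.\<close>
    proof (cases "q \<in> fst c")
      case True
      let ?U = "snd d ` (fst d \<inter> fst c)" and ?T = "snd c ` (fst c \<inter> fst d)"
      have U: "open ?U" and T: "open ?T"
        by (rule chart_image_open(1)[OF chart chart_open(1)[OF chart]]; fact)+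
      have sub: "transition d c ` ?U \<subseteq> ?T"
        by (auto simp: transition_def coord_inv_snd[OF chart[OF d]])
      have sm: "smooth_on ?U (transition d c)" by (rule smooth_transition[OF A d c])
      have D: "smooth_on ?T (\<lambda>z. dir_deriv (transition c d) z u)"
        by (rule smooth_on_dir_deriv_const[OF smooth_transition[OF A c d]])
      have "smooth_on ?U (\<lambda>y. \<eta> (transition d c y) *\<^sub>R dir_deriv (transition c d) (transition d c y) u)"
        by (rule smooth_on_scaleR[OF U
            smooth_on_compose[where H = \<eta>, OF U open_UNIV subset_UNIV \<eta>(1) sm]
            smooth_on_compose[where H = "\<lambda>z. dir_deriv (transition c d) z u", OF U T sub D sm]])
      moreover have "X d z = \<eta> (transition d c z) *\<^sub>R dir_deriv (transition c d) (transition d c z) u"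
        if "z \<in> ?U" for z
        using that Xp[OF d] by (auto simp: transition_def coord_inv_snd[OF chart[OF d]])
      ultimately have "smooth_on ?U (X d)" by (subst smooth_on_cong[OF U])
      then show ?thesis using U True q by blast
    next
      case False
      let ?U = "{y \<in> chart_image d. coord_inv d y \<in> - K}"
      have U: "open ?U" by (rule chart_image_open(2)[OF chart[OF d] K])
      have "K \<subseteq> fst c" unfolding K_def using coord_inv_in[OF chart[OF c]] r(2) by blast
      then have "y \<in> ?U" using False y by (auto simp: q_def)
      moreover have "X d z = 0" if "z \<in> ?U" for z
        using that \<eta>0 by (auto simp: X_def Let_def)
      then have "smooth_on ?U (X d)"
        using smooth_on_cong[OF U, of "X d" "\<lambda>_. 0"] smooth_on_const by blast
      ultimately show ?thesis using U by blast
    qed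
  qed
  moreover have "X e (snd e p) = frechet_derivative (transition d e) (at (snd d p)) (X d (snd d p))"
    if d: "d \<in> A" and e: "e \<in> A" and p: "p \<in> fst d \<inter> fst e" for d e p
  proof -
    have lin: "linear (dir_deriv (transition d e) (snd d p))"
      using linear_dir_deriv[OF transition_differentiable[OF A d e]] p by blast
    have "X e (snd e p) = dir_deriv (transition d e) (snd d p) (X d (snd d p))"
      using p dir_deriv_transition_chain[OF A c d e, of p u]
      by (auto simp: Xp[OF d] Xp[OF e] linear_scale[OF lin] linear_0[OF lin])
    then show ?thesis by (simp add: dir_deriv_def)
  qed
  ultimately have "vector_field A X" unfolding vector_field_def by blast
  moreover have "X c y = u" if "y \<in> ball x (r / 2)" for y
  proof -
    have y: "y \<in> chart_image c" using that r by (force simp: subset_iff)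
    have "dir_deriv (transition c c) y = dir_deriv (\<lambda>y. y) y"
      by (rule dir_deriv_cong_open[OF chart_open(2)[OF chart[OF c]] y])
        (simp add: transition_def snd_coord_inv[OF chart[OF c]])
    then show ?thesis
      using y that \<eta>(2) coord_inv_in[OF chart[OF c] y] snd_coord_inv[OF chart[OF c] y]
      by (simp add: X_def)
  qed
  moreover have "ball x (r / 2) \<subseteq> chart_image c" using r by (force simp: subset_iff)
  ultimately show ?thesis using r(1) by (intro exI[of _ X] exI[of _ "ball x (r / 2)"]) simp
qed

section \<open>Global consequences of the soliton equation\<close>

lemma metric_on_chart:
  assumes "smooth_atlas A" "riemannian_metric A G" "c \<in> A"
  shows "metric_on (chart_image c) (G c)"
proof (rule metric_on.intro)
  show "open (chart_image c)" by (rule chart_open(2)[OF atlas_chart[OF assms(1,3)]])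
  show "inner_form (G c x)" if "x \<in> chart_image c" for x
    using assms(2,3) that unfolding riemannian_metric_def inner_form_def by blast
  show "smooth_on (chart_image c) (\<lambda>x. G c x u v)" for u v
    using assms(2,3) unfolding riemannian_metric_def by blast
qed

text \<open>The definition tests the condition on global fields. Choosing fields that are constant
  near the point turns it into an equation for the coordinate expression and arbitrary vectors
  \<open>u\<close>, \<open>v\<close>.\<close>

lemma affine_conformal_lie_christoffel:
  assumes A: "smooth_atlas A" and G: "riemannian_metric A G" and V: "affine_conformal A G V f"
    and c: "c \<in> A" and x: "x \<in> chart_image c"
  shows "metric_on.lie_christoffel (G c) (V c) x u v =
    dir_deriv (f \<circ> coord_inv c) x u *\<^sub>R v + dir_deriv (f \<circ> coord_inv c) x v *\<^sub>R u
      - G c x u v *\<^sub>R gradient (G c) (f \<circ> coord_inv c) x"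
proof -
  interpret metric_on "chart_image c" "G c" by (rule metric_on_chart[OF A G c])
  obtain X U where X: "vector_field A X" "open U" "x \<in> U" "U \<subseteq> chart_image c" "\<forall>y\<in>U. X c y = u"
    using ex_vector_field_locally_constant[OF A c x] by blast
  obtain Y U' where Y: "vector_field A Y" "open U'" "x \<in> U'" "U' \<subseteq> chart_image c" "\<forall>y\<in>U'. Y c y = v"
    using ex_vector_field_locally_constant[OF A c x] by blast
  have "smooth_on (chart_image c) (V c)"
    using V c unfolding affine_conformal_def vector_field_def by blast
  then have "lie_connection (G c) (V c) (X c) (Y c) x = lie_christoffel (V c) x u v"
    using X Y by (intro lie_connection_locally_constant[where U = "U \<inter> U'"] open_Int) blast+
  moreover have "lie_connection (G c) (V c) (X c) (Y c) x =
      dir_deriv (f \<circ> coord_inv c) x (X c x) *\<^sub>R Y c x + dir_deriv (f \<circ> coord_inv c) x (Y c x) *\<^sub>R X c x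
      - G c x (X c x) (Y c x) *\<^sub>R gradient (G c) (f \<circ> coord_inv c) x"
    using V[unfolded affine_conformal_def, THEN conjunct2, THEN conjunct2, rule_format, OF X(1) Y(1) c x] .
  ultimately show ?thesis using X(3,5) Y(3,5) by simp
qed

text \<open>Coordinate balls are convex, so a vanishing derivative makes \<mu> constant on them;
  connectedness passes from locally constant to constant.\<close>

lemma constant_on_iff_dir_deriv_zero:
  fixes A :: "('m::{t2_space, second_countable_topology}, 'a::euclidean_space) chart set"
    and \<mu> :: "'m \<Rightarrow> real"
  assumes A: "smooth_atlas A" and conn: "connected (UNIV :: 'm set)"
    and \<mu>: "\<And>c x. c \<in> A \<Longrightarrow> x \<in> chart_image c \<Longrightarrow> (\<mu> \<circ> coord_inv c) differentiable (at x)"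
  shows "\<mu> constant_on UNIV \<longleftrightarrow>
    (\<forall>c\<in>A. \<forall>x\<in>chart_image c. \<forall>z. dir_deriv (\<mu> \<circ> coord_inv c) x z = 0)"
proof
  assume "\<mu> constant_on UNIV"
  then obtain k where k: "\<forall>p. \<mu> p = k" unfolding constant_on_def by blast
  have "\<mu> = (\<lambda>_. k)" by (rule ext) (rule k[rule_format])
  then show "\<forall>c\<in>A. \<forall>x\<in>chart_image c. \<forall>z. dir_deriv (\<mu> \<circ> coord_inv c) x z = 0"
    by (simp add: o_def)
next
  assume 0: "\<forall>c\<in>A. \<forall>x\<in>chart_image c. \<forall>z. dir_deriv (\<mu> \<circ> coord_inv c) x z = 0"
  show "\<mu> constant_on UNIV"
  proof (rule locally_constant_imp_constant[OF conn])
    fix p :: 'm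
    obtain c where c: "c \<in> A" "p \<in> fst c" using atlas_cover[OF A] by blast
    note chart = atlas_chart[OF A c(1)]
    obtain r where r: "r > 0" "ball (snd c p) r \<subseteq> chart_image c"
      using chart_open(2)[OF chart] snd_in_chart_image[OF c(2)] open_contains_ball by blast
    define T where "T = fst c \<inter> snd c -` ball (snd c p) r"
    have "open T"
      unfolding T_def by (rule continuous_open_preimage[OF chart_continuous(1) chart_open(1)])
        (simp_all add: chart)
    then have "openin (top_of_set UNIV) T" by simp
    moreover have "p \<in> T" using c r by (simp add: T_def)
    moreover have "\<mu> q = \<mu> p" if "q \<in> T" for q
    proof -
      have "(\<mu> \<circ> coord_inv c) (snd c q) = (\<mu> \<circ> coord_inv c) (snd c p)"
      proof (rule has_derivative_zero_unique[where s = "ball (snd c p) r"])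
        fix y assume "y \<in> ball (snd c p) r"
        then have y: "y \<in> chart_image c" using r by blast
        have "dir_deriv (\<mu> \<circ> coord_inv c) y = (\<lambda>_. 0)" by (rule ext) (rule 0[rule_format, OF c(1) y])
        with has_dir_deriv[OF \<mu>[OF c(1) y]]
        have "(\<mu> \<circ> coord_inv c has_derivative (\<lambda>h. 0)) (at y)" by simp
        then show "(\<mu> \<circ> coord_inv c has_derivative (\<lambda>h. 0)) (at y within ball (snd c p) r)"
          by (rule has_derivative_at_withinI)
      qed (use that r in \<open>auto simp: T_def convex_ball\<close>)
      then show ?thesis
        using that c coord_inv_snd[OF chart] by (simp add: T_def)
    qed
    ultimately show "\<exists>T. openin (top_of_set UNIV) T \<and> p \<in> T \<and> (\<forall>q\<in>T. \<mu> q = \<mu> p)"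
      by blast
  qed
qed

text \<open>\<open>constant_on_iff_dir_deriv_zero\<close> concerns functions on the manifold,
  whereas |P|^2 is given chart by chart. By the transformation laws of the metric and of
  \<open>P\<close>, an arbitrarily chosen chart gives the same value.\<close>

lemma ex_squared_length:
  assumes A: "smooth_atlas A" and G: "riemannian_metric A G" and P: "vector_field A P"
  shows "\<exists>Q. \<forall>c\<in>A. \<forall>x\<in>chart_image c. Q (coord_inv c x) = G c x (P c x) (P c x)"
proof -
  define Q where "Q p = (let c = SOME c. c \<in> A \<and> p \<in> fst c
    in G c (snd c p) (P c (snd c p)) (P c (snd c p)))" for p
  have "Q (coord_inv c x) = G c x (P c x) (P c x)" if c: "c \<in> A" and x: "x \<in> chart_image c" for c x
  proof -
    define p where "p = coord_inv c x"
    have p: "p \<in> fst c" "snd c p = x"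
      unfolding p_def using coord_inv_in[OF atlas_chart[OF A c] x] snd_coord_inv[OF atlas_chart[OF A c] x] by auto
    define d where "d = (SOME d. d \<in> A \<and> p \<in> fst d)"
    have d: "d \<in> A" "p \<in> fst d"
      using someI_ex[of "\<lambda>d. d \<in> A \<and> p \<in> fst d"] atlas_cover[OF A, of p] unfolding d_def by blast+
    let ?D = "frechet_derivative (transition c d) (at (snd c p))"
    have "G c (snd c p) (P c (snd c p)) (P c (snd c p)) =
        G d (snd d p) (?D (P c (snd c p))) (?D (P c (snd c p)))"
      using G c d p unfolding riemannian_metric_def by blast
    moreover have "P d (snd d p) = ?D (P c (snd c p))"
      using P c d p unfolding vector_field_def by blast
    ultimately have "G d (snd d p) (P d (snd d p)) (P d (snd d p)) = G c x (P c x) (P c x)"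
      using p by simp
    then show ?thesis by (simp add: Q_def d_def[symmetric] p_def[symmetric])
  qed
  then show ?thesis by blast
qed

theorem theorem3p3:
  fixes A :: "('m::{t2_space, second_countable_topology}, 'a::euclidean_space) chart set"
    and G :: "('m, 'a) chart \<Rightarrow> 'a metric"
    and P V :: "('m, 'a) chart \<Rightarrow> 'a \<Rightarrow> 'a"
    and lam f :: "'m \<Rightarrow> real"
    and \<beta> :: real
  assumes "smooth_atlas A"
    and "connected (UNIV :: 'm set)"
    and "DIM('a) \<ge> 4"
    and "almost_omega_bach_soliton A G P V lam \<beta>"
    and "affine_conformal A G V f"
  shows "((\<forall>c\<in>A. \<forall>x\<in>chart_image c. \<forall>z. divergence (G c) (omega_bach (G c) (P c) \<beta>) x z = 0)
            \<longleftrightarrow> (\<lambda>p. lam p - f p) constant_on UNIV)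
       \<and> ((\<lambda>p. lam p - f p) constant_on UNIV
            \<longleftrightarrow> (\<forall>c\<in>A. \<forall>x\<in>chart_image c. \<forall>u v.
                   omega_bach (G c) (P c) \<beta> x u v = bach (G c) x u v)
              \<or> (\<exists>k. \<forall>c\<in>A. \<forall>x\<in>chart_image c. sqrt (G c x (P c x) (P c x)) = k))"
proof -
  let ?\<mu> = "\<lambda>p. lam p - f p"
  note A = assms(1)
  have G: "riemannian_metric A G" and P: "vector_field A P" and V: "vector_field A V"
    and lam: "smooth_function A lam" and f: "smooth_function A f"
    using assms(4,5) by (auto simp: almost_omega_bach_soliton_def affine_conformal_def)
  have sm: "smooth_on (chart_image c) (P c)" "smooth_on (chart_image c) (V c)"
    "smooth_on (chart_image c) (lam \<circ> coord_inv c)" "smooth_on (chart_image c) (f \<circ> coord_inv c)"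
    if "c \<in> A" for c
    using that P V lam f by (auto simp: vector_field_def smooth_function_def)
  obtain Q where Q: "\<forall>c\<in>A. \<forall>x\<in>chart_image c. Q (coord_inv c x) = G c x (P c x) (P c x)"
    using ex_squared_length[OF A G P] by blast
  \<comment> \<open>The trace of B_\<omega> as a function on the manifold.\<close>
  define \<rho> where "\<rho> p = - \<beta> * Q p" for p
  have \<mu>_comp: "(?\<mu> \<circ> coord_inv c) = (\<lambda>y. (lam \<circ> coord_inv c) y - (f \<circ> coord_inv c) y)" for c
    by (simp add: fun_eq_iff)
  have local: "divergence (G c) (omega_bach (G c) (P c) \<beta>) x z = dir_deriv (?\<mu> \<circ> coord_inv c) x z"
    "dir_deriv (\<rho> \<circ> coord_inv c) x z = real DIM('a) * dir_deriv (?\<mu> \<circ> coord_inv c) x z"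
    "(?\<mu> \<circ> coord_inv c) differentiable (at x)" "(\<rho> \<circ> coord_inv c) differentiable (at x)"
    if c: "c \<in> A" and x: "x \<in> chart_image c" for c x z
  proof -
    interpret metric_on "chart_image c" "G c" by (rule metric_on_chart[OF A G c])
    have soliton: "1 / 2 * lie_metric (G c) (V c) (\<lambda>_. u) (\<lambda>_. v) y + omega_bach (G c) (P c) \<beta> y u v
        = (lam \<circ> coord_inv c) y * G c y u v" if "y \<in> chart_image c" for y u v
      using assms(4) c that by (simp add: almost_omega_bach_soliton_def)
    have n: "DIM('a) \<ge> 3" using assms(3) by simp
    note loc = soliton_local[OF sm(2-4)[OF c] soliton
        affine_conformal_lie_christoffel[OF A G assms(5) c] x n]
    show "divergence (G c) (omega_bach (G c) (P c) \<beta>) x z = dir_deriv (?\<mu> \<circ> coord_inv c) x z"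
      unfolding \<mu>_comp by (rule loc(1))
    have eq: "(\<rho> \<circ> coord_inv c) y = - \<beta> * G c y (P c y) (P c y)" if "y \<in> chart_image c" for y
      using Q c that by (simp add: \<rho>_def)
    have "dir_deriv (\<rho> \<circ> coord_inv c) x = dir_deriv (\<lambda>y. - \<beta> * G c y (P c y) (P c y)) x"
      by (rule dir_deriv_cong_open[OF open_S x]) (rule eq)
    then show "dir_deriv (\<rho> \<circ> coord_inv c) x z = real DIM('a) * dir_deriv (?\<mu> \<circ> coord_inv c) x z"
      unfolding \<mu>_comp by (simp only: loc(2))
    show "(?\<mu> \<circ> coord_inv c) differentiable (at x)"
      unfolding \<mu>_comp
      by (rule smooth_on_differentiable[OF smooth_on_diff[OF open_S sm(3,4)[OF c]] x])
    have "smooth_on (chart_image c) (\<lambda>y. - \<beta> * G c y (P c y) (P c y))"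
      by (rule smooth_on_mult[OF open_S smooth_on_const smooth_on_metric[OF sm(1,1)[OF c]]])
    then have "smooth_on (chart_image c) (\<rho> \<circ> coord_inv c)"
      by (subst smooth_on_cong[OF open_S eq])
    then show "(\<rho> \<circ> coord_inv c) differentiable (at x)"
      using x by (rule smooth_on_differentiable)
  qed
  have \<mu>_iff: "?\<mu> constant_on UNIV \<longleftrightarrow>
      (\<forall>c\<in>A. \<forall>x\<in>chart_image c. \<forall>z. dir_deriv (?\<mu> \<circ> coord_inv c) x z = 0)"
    by (rule constant_on_iff_dir_deriv_zero[OF A assms(2) local(3)])
  have "\<rho> constant_on UNIV \<longleftrightarrow>
      (\<forall>c\<in>A. \<forall>x\<in>chart_image c. \<forall>z. dir_deriv (\<rho> \<circ> coord_inv c) x z = 0)"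
    by (rule constant_on_iff_dir_deriv_zero[OF A assms(2) local(4)])
  \<comment> \<open>The derivatives of \<rho> and \<mu> differ by the nonzero factor
    \<open>DIM('a)\<close>, so they vanish together.\<close>
  then have \<rho>_iff: "?\<mu> constant_on UNIV \<longleftrightarrow> \<rho> constant_on UNIV"
    unfolding \<mu>_iff by (simp add: local(2))
  have point: "\<exists>c\<in>A. \<exists>x\<in>chart_image c. coord_inv c x = p" for p
    using atlas_cover[OF A, of p] snd_in_chart_image coord_inv_snd[OF atlas_chart[OF A]] by metis
  \<comment> \<open>Allows |P|^2 to be recovered from its square root below.\<close>
  have nonneg: "G c x (P c x) (P c x) \<ge> 0" if "c \<in> A" "x \<in> chart_image c" for c x
  proof -
    interpret inner_form "G c x"
      using metric_on.inner_form[OF metric_on_chart[OF A G that(1)] that(2)] .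
    show ?thesis
      using pos[of "P c x"] linear_0[OF linear_left, of 0] by (cases "P c x = 0") (auto simp: less_imp_le)
  qed
  have "\<rho> constant_on UNIV \<longleftrightarrow>
      (\<forall>c\<in>A. \<forall>x\<in>chart_image c. \<forall>u v. omega_bach (G c) (P c) \<beta> x u v = bach (G c) x u v)
        \<or> (\<exists>k. \<forall>c\<in>A. \<forall>x\<in>chart_image c. sqrt (G c x (P c x) (P c x)) = k)"
    (is "_ \<longleftrightarrow> ?B \<or> ?L")
  proof
    assume "\<rho> constant_on UNIV"
    then obtain k where k: "\<forall>p. - \<beta> * Q p = k" unfolding constant_on_def \<rho>_def by blast
    show "?B \<or> ?L"
    \<comment> \<open>For \<beta> = 0 the tensors B_\<omega> and B coincide; otherwise division by
      \<beta> makes |P|^2 constant.\<close>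
    proof (cases "\<beta> = 0")
      case True
      then show ?thesis by (simp add: omega_bach_def)
    next
      case False
      then have "Q p = - k / \<beta>" for p using k[rule_format, of p] by (simp add: field_simps)
      then have "\<forall>c\<in>A. \<forall>x\<in>chart_image c. sqrt (G c x (P c x) (P c x)) = sqrt (- k / \<beta>)"
        using Q by metis
      then show ?thesis by blast
    qed
  next
    assume "?B \<or> ?L"
    then have "\<exists>k. \<forall>c\<in>A. \<forall>x\<in>chart_image c. - \<beta> * G c x (P c x) (P c x) = k"
    proof
      assume B: ?B
      \<comment> \<open>Evaluating both tensors on u = v = P gives \<beta> |P|^4 = 0, hence \<beta>
        |P|^2 = 0.\<close>
      have "- \<beta> * G c x (P c x) (P c x) = 0" if "c \<in> A" "x \<in> chart_image c" for c x
        using B[rule_format, OF that, of "P c x" "P c x"] by (simp add: omega_bach_def one_form_def)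
      then show ?thesis by blast
    next
      assume ?L
      then obtain k where "\<forall>c\<in>A. \<forall>x\<in>chart_image c. sqrt (G c x (P c x) (P c x)) = k" by blast
      then have "- \<beta> * G c x (P c x) (P c x) = - \<beta> * k\<^sup>2" if "c \<in> A" "x \<in> chart_image c" for c x
        using real_sqrt_pow2[OF nonneg[OF that]] that by auto
      then show ?thesis by blast
    qed
    then obtain k where k: "\<forall>c\<in>A. \<forall>x\<in>chart_image c. - \<beta> * G c x (P c x) (P c x) = k" by blast
    have "\<rho> p = k" for p
    proof -
      obtain c x where "c \<in> A" "x \<in> chart_image c" "coord_inv c x = p" using point[of p] by blast
      then show ?thesis using Q k by (auto simp: \<rho>_def)
    qed
    then show "\<rho> constant_on UNIV" by (auto simp: constant_on_def)
  qed
  moreover have "(\<forall>c\<in>A. \<forall>x\<in>chart_image c. \<forall>z. divergence (G c) (omega_bach (G c) (P c) \<beta>) x z = 0)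
      \<longleftrightarrow> ?\<mu> constant_on UNIV"
    unfolding \<mu>_iff by (simp add: local(1))
  ultimately show ?thesis using \<rho>_iff by blast
qed

end
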